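(* Let $k \leq n$ be positive integers. The Hilbert series of the graded vector space $R_{n,k}$ is the generating function for $\mathrm{coinv}$ on $\mathcal{OP}_{n,k}$: $$\mathrm{Hilb}(R_{n,k};q) = \sum_{\sigma \in \mathcal{OP}_{n,k}} q^{\mathrm{coinv}(\sigma)} = \mathrm{rev}_q\left([k]!_q \cdot \mathrm{Stir}_q(n,k)\right).$$ In particular, $\dim(R_{n,k}) = |\mathcal{OP}_{n,k}| = k! \cdot \mathrm{Stir}(n,k)$.
   Context: For positive integers $k \le n$, $I_{n,k} \subseteq \mathbb{Q}[x_1,\dots,x_n]$ is the ideal $\langle x_1^k, \dots, x_n^k, e_n, e_{n-1}, \dots, e_{n-k+1}\rangle$, where $e_d = e_d(x_1,\dots,x_n)$ is the elementary symmetric polynomial of degree $d$, and $R_{n,k} := \mathbb{Q}[x_1,\dots,x_n]/I_{n,k}$, graded by degree. $\mathrm{Hilb}(V;q) = \sum_{d\ge 0} \dim(V_d) q^d$. $\mathcal{OP}_{n,k}$ is the set of ordered set partitions $\sigma = (B_1 \mid \cdots \mid B_k)$ of $[n]=\{1,\dots,n\}$ into $k$ nonempty blocks. An inversion of $\sigma$ is a pair of letters $i<j$ such that $i$ is the minimum of its block $B_m$, $j \in B_\ell$, and $\ell < m$; $\mathrm{inv}(\sigma)$ is the number of inversions, and $\mathrm{coinv}(\sigma) := (n-k)(k-1) + \binom{k}{2} - \mathrm{inv}(\sigma)$. $[k]_q = 1+q+\cdots+q^{k-1}$ and $[k]!_q = [k]_q[k-1]_q\cdots[1]_q$. $\mathrm{Stir}(n,k)$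 is the Stirling number of the second kind. The $q$-Stirling numbers are defined by $\mathrm{Stir}_q(n,k) = \mathrm{Stir}_q(n-1,k-1) + [k]_q\,\mathrm{Stir}_q(n-1,k)$, with $\mathrm{Stir}_q(1,1) = 1$, $\mathrm{Stir}_q(1,k) = 0$ for $k>1$, and $\mathrm{Stir}_q(n,0)=0$ for $n \geq 1$. For $f = a_d q^d + \cdots + a_0$ with $a_d \neq 0$, $\mathrm{rev}_q(f) = a_0 q^d + a_1 q^{d-1} + \cdots + a_d$. *)

theory Defs
  imports
    "HOL-Library.Poly_Mapping"
    "HOL-Library.Disjoint_Sets"
    "HOL-Computational_Algebra.Polynomial_FPS"
    "HOL-Combinatorics.Stirling"
    "HOL-Algebra.QuotRing"
    "HOL-Algebra.Embedded_Algebras"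
begin

section \<open>Polynomials over the rationals in finitely many variables\<close>

text \<open>
  A monomial is its finitely supported exponent vector. The type \<open>mpoly\<close> has a variable for every
  natural number; the ring \<open>\<rat>[x\<^sub>1,\<dots>,x\<^sub>n]\<close> is its subring of polynomials involving only the
  variables with index in \<open>{1..n}\<close>.
\<close>

type_synonym mpoly = "(nat \<Rightarrow>\<^sub>0 nat) \<Rightarrow>\<^sub>0 rat"

definition mconst :: "rat \<Rightarrow> mpoly" where
  "mconst c = Poly_Mapping.single 0 c"

definition mvar :: "nat \<Rightarrow> mpoly" where
  "mvar i = Poly_Mapping.single (Poly_Mapping.single i 1) 1"

definition mon_degree :: "(nat \<Rightarrow>\<^sub>0 nat) \<Rightarrow> nat" where
  "mon_degree m = (\<Sum>i\<in>Poly_Mapping.keys m. Poly_Mapping.lookup m i)"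

definition homogeneous :: "nat \<Rightarrow> mpoly \<Rightarrow> bool" where
  "homogeneous d p \<longleftrightarrow> (\<forall>m\<in>Poly_Mapping.keys p. mon_degree m = d)"

definition mpolys :: "nat \<Rightarrow> mpoly set" where
  "mpolys n = {p. \<forall>m\<in>Poly_Mapping.keys p. Poly_Mapping.keys m \<subseteq> {1..n}}"

definition mpoly_ring :: "nat \<Rightarrow> mpoly ring" where
  "mpoly_ring n = \<lparr>carrier = mpolys n, monoid.mult = (*), one = 1, zero = 0, add = (+)\<rparr>"

lemma mpolys_0: "0 \<in> mpolys n"
  by (simp add: mpolys_def)

lemma mpolys_1: "1 \<in> mpolys n"
  by (simp add: mpolys_def)

lemma mpolys_add: "p \<in> mpolys n \<Longrightarrow> q \<in> mpolys n \<Longrightarrow> p + q \<in> mpolys n"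
  unfolding mpolys_def using Poly_Mapping.keys_add[of p q] by blast

lemma mpolys_uminus: "p \<in> mpolys n \<Longrightarrow> - p \<in> mpolys n"
  by (simp add: mpolys_def)

lemma mpolys_mult:
  assumes "p \<in> mpolys n" "q \<in> mpolys n"
  shows "p * q \<in> mpolys n"
proof -
  have "Poly_Mapping.keys m \<subseteq> {1..n}" if m: "m \<in> Poly_Mapping.keys (p * q)" for m
  proof -
    obtain a b where ab: "a \<in> Poly_Mapping.keys p" "b \<in> Poly_Mapping.keys q" "m = a + b"
      using m keys_mult[of p q] by blast
    have "Poly_Mapping.keys a \<subseteq> {1..n}" "Poly_Mapping.keys b \<subseteq> {1..n}"
      using ab assms unfolding mpolys_def by blast+
    then show ?thesis
      using Poly_Mapping.keys_add[of a b] ab(3) by blast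
  qed
  then show ?thesis
    by (simp add: mpolys_def)
qed

lemma mpoly_ring_cring: "cring (mpoly_ring n)"
proof (rule cringI)
  show "abelian_group (mpoly_ring n)"
  proof (rule abelian_groupI)
    fix x assume x: "x \<in> carrier (mpoly_ring n)"
    show "\<exists>y\<in>carrier (mpoly_ring n). y \<oplus>\<^bsub>mpoly_ring n\<^esub> x = \<zero>\<^bsub>mpoly_ring n\<^esub>"
      using x by (intro bexI[of _ "- x"]) (auto simp: mpoly_ring_def mpolys_uminus)
  qed (auto simp: mpoly_ring_def mpolys_0 mpolys_add algebra_simps)
  show "comm_monoid (mpoly_ring n)"
    by (rule comm_monoidI) (auto simp: mpoly_ring_def mpolys_1 mpolys_mult algebra_simps)
qed (auto simp: mpoly_ring_def algebra_simps)

definition elem_sym :: "nat \<Rightarrow> nat \<Rightarrow> mpoly" where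
  "elem_sym n d = (\<Sum>S | S \<subseteq> {1..n} \<and> card S = d. \<Prod>i\<in>S. mvar i)"


section \<open>The graded quotient ring\<close>

definition ideal_I :: "nat \<Rightarrow> nat \<Rightarrow> mpoly set" where
  "ideal_I n k =
     Idl\<^bsub>mpoly_ring n\<^esub> ((\<lambda>i. mvar i ^ k) ` {1..n} \<union> elem_sym n ` {n - k + 1..n})"

definition ring_R :: "nat \<Rightarrow> nat \<Rightarrow> mpoly set ring" where
  "ring_R n k = mpoly_ring n Quot ideal_I n k"

text \<open>The canonical copy of \<open>\<rat>\<close> in the quotient, over which dimensions are taken.\<close>

definition scalars :: "nat \<Rightarrow> nat \<Rightarrow> mpoly set set" where
  "scalars n k = range (\<lambda>c. ideal_I n k +>\<^bsub>mpoly_ring n\<^esub> mconst c)"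

text \<open>The ideal is generated by homogeneous polynomials, so the degree \<open>d\<close> part of the quotient
  is the image of the homogeneous polynomials of degree \<open>d\<close>.\<close>

definition graded_part :: "nat \<Rightarrow> nat \<Rightarrow> nat \<Rightarrow> mpoly set set" where
  "graded_part n k d =
     (\<lambda>p. ideal_I n k +>\<^bsub>mpoly_ring n\<^esub> p) ` {p \<in> mpolys n. homogeneous d p}"

definition dim_Q :: "nat \<Rightarrow> nat \<Rightarrow> mpoly set set \<Rightarrow> nat" where
  "dim_Q n k V = ring.dim (ring_R n k) (scalars n k) V"

definition Hilb :: "nat \<Rightarrow> nat \<Rightarrow> int fps" where
  "Hilb n k = Abs_fps (\<lambda>d. int (dim_Q n k (graded_part n k d)))"


section \<open>Ordered set partitions\<close>

definition OP :: "nat \<Rightarrow> nat \<Rightarrow> nat set list set" where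
  "OP n k = {\<sigma>. length \<sigma> = k \<and> distinct \<sigma> \<and> partition_on {1..n} (set \<sigma>)}"

definition osp_inversions :: "nat set list \<Rightarrow> (nat \<times> nat) set" where
  "osp_inversions \<sigma> =
     {(i, j). i < j \<and> (\<exists>l m. l < m \<and> m < length \<sigma> \<and> i = Min (\<sigma> ! m) \<and> j \<in> \<sigma> ! l)}"

definition osp_inv :: "nat set list \<Rightarrow> nat" where
  "osp_inv \<sigma> = card (osp_inversions \<sigma>)"

text \<open>The outer subtraction of natural numbers does not truncate on \<open>OP n k\<close>; see
  \<open>osp_inv_le\<close> below.\<close>

definition coinv :: "nat \<Rightarrow> nat \<Rightarrow> nat set list \<Rightarrow> nat" where
  "coinv n k \<sigma> = (n - k) * (k - 1) + (k choose 2) - osp_inv \<sigma>"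

lemma osp_inv_le:
  assumes "\<sigma> \<in> OP n k"
  shows "osp_inv \<sigma> \<le> (n - k) * (k - 1) + (k choose 2)"
proof -
  have len: "length \<sigma> = k" and dist: "distinct \<sigma>" and part: "partition_on {1..n} (set \<sigma>)"
    using assms by (auto simp: OP_def)
  have sub: "B \<subseteq> {1..n}" if "B \<in> set \<sigma>" for B
    using part that by (auto simp: partition_on_def)
  have fin: "finite B" if "B \<in> set \<sigma>" for B
    using sub[OF that] finite_subset by blast
  have Min_in: "Min B \<in> B" if "B \<in> set \<sigma>" for B
    using part that fin[OF that] by (intro Min_in) (auto simp: partition_on_def)
  define M where "M = Min ` set \<sigma>"
  have "inj_on Min (set \<sigma>)"
  proof (rule inj_onI)
    fix A B assume "A \<in> set \<sigma>" "B \<in> set \<sigma>" "Min A = Min B"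
    then show "A = B"
      using Min_in[of A] Min_in[of B] part unfolding partition_on_def disjoint_def
      by (metis IntI empty_iff)
  qed
  then have cM: "card M = k"
    by (simp add: M_def card_image distinct_card[OF dist] len)
  have M_sub: "M \<subseteq> {1..n}"
    using Min_in sub by (auto simp: M_def)
  have fM: "finite M"
    by (simp add: M_def)
  define I1 where "I1 = {(i, j) \<in> osp_inversions \<sigma>. j \<in> M}"
  define I2 where "I2 = {(i, j) \<in> osp_inversions \<sigma>. j \<notin> M}"
  have split: "osp_inversions \<sigma> = I1 \<union> I2"
    by (auto simp: I1_def I2_def)
  have "card I1 \<le> card {A. A \<subseteq> M \<and> card A = 2}"
  proof (rule card_inj_on_le[where f = "\<lambda>(i, j). {i, j}"])
    show "inj_on (\<lambda>(i, j). {i, j}) I1"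
      by (rule inj_onI) (auto simp: I1_def osp_inversions_def doubleton_eq_iff)
    show "(\<lambda>(i, j). {i, j}) ` I1 \<subseteq> {A. A \<subseteq> M \<and> card A = 2}"
      by (auto simp: I1_def osp_inversions_def M_def)
    show "finite {A. A \<subseteq> M \<and> card A = 2}"
      using fM by simp
  qed
  then have c1: "card I1 \<le> k choose 2"
    using n_subsets[OF fM, of 2] by (simp add: cM)
  have I2_sub: "I2 \<subseteq> (\<lambda>(j, m). (Min (\<sigma> ! m), j)) ` (({1..n} - M) \<times> {1..<k})"
  proof
    fix x assume "x \<in> I2"
    then obtain i j l m where x: "x = (i, j)" "j \<notin> M" "l < m" "m < length \<sigma>"
      "i = Min (\<sigma> ! m)" "j \<in> \<sigma> ! l"
      by (auto simp: I2_def osp_inversions_def)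
    have "j \<in> {1..n}"
      using x sub[of "\<sigma> ! l"] by auto
    then show "x \<in> (\<lambda>(j, m). (Min (\<sigma> ! m), j)) ` (({1..n} - M) \<times> {1..<k})"
      using x len by (intro image_eqI[of _ _ "(j, m)"]) auto
  qed
  have c2: "card I2 \<le> (n - k) * (k - 1)"
  proof -
    have "card I2 \<le> card (({1..n} - M) \<times> {1..<k})"
      by (rule surj_card_le[OF _ I2_sub]) simp
    also have "\<dots> = (n - k) * (k - 1)"
      using card_Diff_subset[OF fM M_sub] by (simp add: card_cartesian_product cM)
    finally show ?thesis .
  qed
  show ?thesis
    unfolding osp_inv_def split using card_Un_le[of I1 I2] c1 c2 by linarith
qed


section \<open>q-analogues\<close>

definition q_int :: "nat \<Rightarrow> int poly" where
  "q_int k = (\<Sum>i<k. Polynomial.monom 1 i)"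

definition q_fact :: "nat \<Rightarrow> int poly" where
  "q_fact k = (\<Prod>i = 1..k. q_int i)"

text \<open>Only the values with \<open>n \<ge> 1\<close> are meaningful; those at \<open>n = 0\<close> are a junk value.\<close>

fun q_stirling :: "nat \<Rightarrow> nat \<Rightarrow> int poly" where
  "q_stirling n 0 = 0"
| "q_stirling 0 (Suc k) = 0"
| "q_stirling (Suc 0) (Suc k) = (if k = 0 then 1 else 0)"
| "q_stirling (Suc (Suc n)) (Suc k) =
     q_stirling (Suc n) k + q_int (Suc k) * q_stirling (Suc n) (Suc k)"

text \<open>Reversal of the coefficient sequence of a polynomial is \<^const>\<open>reflect_poly\<close>.\<close>

end

theory Submission
  imports Defs "HOL-Library.Function_Algebras"
begin

text \<open>
  More generally let \<open>I\<^sub>n\<^sub>,\<^sub>k\<^sub>,\<^sub>s\<close> be generated by the \<open>x\<^sub>i\<^sup>k\<close> and the \<open>e\<^sub>r\<close> with \<open>r > n - s\<close>. Filtering by powers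
  of the last variable, the layer of \<open>x\<^sub>n\<^sup>i\<close> is a quotient of the ring for \<open>(n - 1, k, s - 1)\<close> if
  \<open>i < s\<close> and of the ring for \<open>(n - 1, k, s)\<close> if \<open>s \<le> i < k\<close>; this yields recursively a spanning set of
  monomials, whose degree generating function for \<open>s = k\<close> satisfies the recursion of the coinversion
  generating function obtained by deleting the letter \<open>n\<close>. In particular there are as many of these
  monomials as ordered set partitions. Conversely, send an ordered set partition to the point whose
  \<open>i\<close>-th coordinate is the index of the block of \<open>i\<close>. On the set of these points every generator of
  the ideal agrees with a polynomial of lower degree, so any homogeneous spanning set of the quotient
  spans all functions on the point set. Hence no monomial of the spanning set can be dropped.
\<close>

section \<open>Monomials and the rational vector space of polynomials\<close>

text \<open>The recursion in the last variable keeps \<open>k\<close> fixed and lowers only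
  \<open>s\<close>, whereas deleting the letter \<open>n\<close> from an ordered set partition can
  lower \<open>k\<close>; the bridge between the two is \<open>stairs_gf_split\<close>. The layers
  are only shown to be spanned by the expected monomials, which bounds dimensions from above; the
  point set bounds the total from below, and equality of the totals settles every degree at once.
  Replacing generators by polynomials of lower degree gives an induction only if each relation used
  stays in one degree, so subspaces are kept degree by degree (\<open>igens\<close>,
  \<open>hspan\<close>) and the ideal itself enters last. That the elementary symmetric generators
  lose degree on the points comes from a generating function: as every value \<open>l < k\<close> is
  a coordinate, dividing the product of all \<open>1 + x_i q\<close> by the product of the
  \<open>1 + l q\<close> leaves a product of \<open>n - k\<close> factors. Its coefficients beyond
  \<open>q^(n-k)\<close> vanish, while as polynomials in the variables these coefficients have
  leading form \<open>e_r\<close>.\<close>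

definition mmon :: "(nat \<Rightarrow>\<^sub>0 nat) \<Rightarrow> mpoly" where
  "mmon t = Poly_Mapping.single t 1"

definition expos :: "nat \<Rightarrow> (nat \<Rightarrow>\<^sub>0 nat) set" where
  "expos n = {t. Poly_Mapping.keys t \<subseteq> {1..n}}"

lemma mon_degree_superset:
  assumes "finite A" "Poly_Mapping.keys t \<subseteq> A"
  shows "mon_degree t = (\<Sum>i\<in>A. Poly_Mapping.lookup t i)"
  unfolding mon_degree_def using assms
  by (intro sum.mono_neutral_left) (auto simp: in_keys_iff)

lemma mon_degree_zero [simp]: "mon_degree 0 = 0"
  by (simp add: mon_degree_def)

lemma mon_degree_single [simp]: "mon_degree (Poly_Mapping.single i e) = e"
  by (simp add: mon_degree_def)

lemma mon_degree_add [simp]: "mon_degree (s + t) = mon_degree s + mon_degree t"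
proof -
  let ?A = "Poly_Mapping.keys s \<union> Poly_Mapping.keys t"
  have "Poly_Mapping.keys (s + t) \<subseteq> ?A"
    by (rule Poly_Mapping.keys_add)
  then show ?thesis
    by (simp add: mon_degree_superset[of ?A] lookup_add sum.distrib)
qed

lemma expos_zero [simp]: "0 \<in> expos n"
  by (simp add: expos_def)

lemma expos_add: "s \<in> expos n \<Longrightarrow> t \<in> expos n \<Longrightarrow> s + t \<in> expos n"
  unfolding expos_def using Poly_Mapping.keys_add[of s t] by blast

lemma expos_single: "i \<in> {1..n} \<Longrightarrow> Poly_Mapping.single i e \<in> expos n"
  by (simp add: expos_def)

lemma expos_mono: "m \<le> n \<Longrightarrow> expos m \<subseteq> expos n"
  unfolding expos_def by force

lemma expos_0: "expos 0 = {0}"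
  by (auto simp: expos_def)

lemma expos_Suc_split:
  assumes "t \<in> expos (Suc n)"
  obtains i u where "u \<in> expos n" "t = Poly_Mapping.single (Suc n) i + u"
proof -
  let ?s = "Poly_Mapping.single (Suc n) (Poly_Mapping.lookup t (Suc n))"
  have lk: "Poly_Mapping.lookup (t - ?s) i = (if i = Suc n then 0 else Poly_Mapping.lookup t i)" for i
    by (simp add: lookup_minus lookup_single when_def)
  have "Poly_Mapping.keys (t - ?s) \<subseteq> {1..n}"
  proof
    fix i assume "i \<in> Poly_Mapping.keys (t - ?s)"
    then have "i \<noteq> Suc n" "i \<in> Poly_Mapping.keys t"
      by (auto simp: in_keys_iff lk split: if_splits)
    then show "i \<in> {1..n}"
      using assms by (force simp: expos_def)
  qed
  moreover have "t = ?s + (t - ?s)"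
    by (rule poly_mapping_eqI) (simp add: lookup_add lookup_minus lookup_single when_def)
  ultimately show thesis
    using that[of "t - ?s"] by (simp add: expos_def)
qed

lemma mmon_mult: "mmon s * mmon t = mmon (s + t)"
  by (simp add: mmon_def mult_single)

lemma mmon_zero [simp]: "mmon 0 = 1"
  by (simp add: mmon_def)

lemma mvar_eq_mmon: "mvar i = mmon (Poly_Mapping.single i 1)"
  by (simp add: mvar_def mmon_def)

lemma mvar_power: "mvar i ^ e = mmon (Poly_Mapping.single i e)"
  by (induction e) (simp_all add: mvar_eq_mmon mmon_mult single_add[symmetric])

lemma mconst_zero [simp]: "mconst 0 = 0"
  and mconst_one [simp]: "mconst 1 = 1"
  by (simp_all add: mconst_def)

lemma mconst_add: "mconst (a + b) = mconst a + mconst b"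
  by (simp add: mconst_def single_add)

lemma mconst_mult: "mconst (a * b) = mconst a * mconst b"
  by (simp add: mconst_def mult_single)

lemma mconst_uminus: "mconst (- a) = - mconst a"
  by (simp add: mconst_def single_uminus)

lemma lookup_mconst_mult [simp]:
  "Poly_Mapping.lookup (mconst c * p) t = c * Poly_Mapping.lookup p t"
  by (simp add: mconst_def Poly_Mapping.map.rep_eq when_def flip: mult_map_scale_conv_mult)

interpretation mp: vector_space "\<lambda>c p. mconst c * p"
  by unfold_locales (simp_all add: mconst_add mconst_mult algebra_simps)

lemma mpoly_as_sum:
  "p = (\<Sum>t\<in>Poly_Mapping.keys p. mconst (Poly_Mapping.lookup p t) * mmon t)"
proof (rule poly_mapping_eqI)
  fix t
  show "Poly_Mapping.lookup p t = Poly_Mapping.lookup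
    (\<Sum>t\<in>Poly_Mapping.keys p. mconst (Poly_Mapping.lookup p t) * mmon t) t"
    by (simp add: lookup_sum mmon_def lookup_single when_def in_keys_iff if_distrib cong: if_cong)
qed

lemma mem_span_mmon: "Poly_Mapping.keys p \<subseteq> S \<Longrightarrow> p \<in> mp.span (mmon ` S)"
  by (subst mpoly_as_sum, intro mp.span_sum mp.span_scale mp.span_base) auto

lemma keys_span_mmon: "p \<in> mp.span (mmon ` S) \<Longrightarrow> Poly_Mapping.keys p \<subseteq> S"
proof (induction rule: mp.span_induct_alt)
  case (step c x y)
  then obtain t where t: "t \<in> S" "x = mmon t"
    by auto
  show ?case
  proof
    fix u assume "u \<in> Poly_Mapping.keys (mconst c * x + y)"
    then show "u \<in> S"
      using t step.IH step.hyps
      by (cases "u = t") (auto simp: in_keys_iff lookup_add mmon_def lookup_single when_def)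
  qed
qed simp

text \<open>Multiplication by \<open>q\<close> is linear, so it is enough to follow it on spanning
  vectors. Degrees and ideal membership are transported under multiplication in this way
  throughout.\<close>

lemma span_mult_closed:
  assumes "\<And>p. p \<in> S \<Longrightarrow> q * p \<in> mp.span T" "p \<in> mp.span S"
  shows "q * p \<in> mp.span T"
  using assms(2)
proof (induction rule: mp.span_induct_alt)
  case (step c x y)
  have "q * (mconst c * x + y) = mconst c * (q * x) + q * y"
    by (simp add: algebra_simps)
  then show ?case
    using step assms(1) by (auto intro!: mp.span_add mp.span_scale)
qed (simp add: mp.span_zero)

section \<open>Elementary symmetric functions\<close>

text \<open>Generic in the ring and in the index set: it is used with the variables themselves, and
  with the rational coordinates of a point after some positions have been removed.\<close>

definition esym :: "('b \<Rightarrow> 'a::comm_ring_1) \<Rightarrow> 'b set \<Rightarrow> nat \<Rightarrow> 'a" where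
  "esym y A r = (\<Sum>S | S \<subseteq> A \<and> card S = r. \<Prod>i\<in>S. y i)"

lemma elem_sym_eq_esym: "elem_sym n r = esym mvar {1..n} r"
  by (simp add: elem_sym_def esym_def)

lemma esym_0: "finite A \<Longrightarrow> esym y A 0 = 1"
proof -
  assume "finite A"
  then have "{S. S \<subseteq> A \<and> card S = 0} = {{}}"
    by (auto dest: finite_subset)
  then show ?thesis
    by (simp add: esym_def)
qed

lemma esym_eq_0: "finite A \<Longrightarrow> card A < r \<Longrightarrow> esym y A r = 0"
proof -
  assume "finite A" "card A < r"
  then have "{S. S \<subseteq> A \<and> card S = r} = {}"
    using card_mono[of A] by (auto simp: not_le[symmetric])
  then show ?thesis
    by (simp only: esym_def sum.empty)
qed

lemma esym_insert:
  assumes "finite A" "a \<notin> A"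
  shows "esym y (insert a A) (Suc r) = esym y A (Suc r) + y a * esym y A r"
proof -
  let ?P = "{S. S \<subseteq> A \<and> card S = Suc r}" and ?Q = "{S. S \<subseteq> A \<and> card S = r}"
  have fin: "finite S" if "S \<subseteq> A" for S
    using that assms(1) finite_subset by blast
  have eq: "{S. S \<subseteq> insert a A \<and> card S = Suc r} = ?P \<union> insert a ` ?Q"
  proof (intro equalityI subsetI)
    fix S assume "S \<in> {S. S \<subseteq> insert a A \<and> card S = Suc r}"
    then have S: "S \<subseteq> insert a A" "card S = Suc r"
      by auto
    show "S \<in> ?P \<union> insert a ` ?Q"
    proof (cases "a \<in> S")
      case True
      then have "S = insert a (S - {a})" "S - {a} \<in> ?Q"
        using S assms by auto
      then show ?thesis
        by blast
    next
      case False
      then show ?thesis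
        using S by auto
    qed
  next
    fix S assume "S \<in> ?P \<union> insert a ` ?Q"
    then show "S \<in> {S. S \<subseteq> insert a A \<and> card S = Suc r}"
    proof
      assume "S \<in> insert a ` ?Q"
      then obtain T where "S = insert a T" "T \<subseteq> A" "card T = r"
        by auto
      moreover from this have "a \<notin> T"
        using assms(2) by auto
      ultimately show ?thesis
        using fin[of T] by auto
    qed auto
  qed
  have inj: "inj_on (insert a) ?Q"
    using assms(2) by (intro inj_on_inverseI[where g = "\<lambda>S. S - {a}"]) auto
  have "(\<Prod>i\<in>insert a S. y i) = y a * (\<Prod>i\<in>S. y i)" if "S \<in> ?Q" for S
    using that assms fin by (subst prod.insert) auto
  then have "(\<Sum>S\<in>insert a ` ?Q. \<Prod>i\<in>S. y i) = y a * (\<Sum>S\<in>?Q. \<Prod>i\<in>S. y i)"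
    by (simp add: sum.reindex[OF inj] sum_distrib_left)
  moreover have "?P \<inter> insert a ` ?Q = {}"
    using assms(2) by auto
  ultimately show ?thesis
    unfolding esym_def eq using assms(1)
    by (subst sum.union_disjoint) (auto simp: mult_ac)
qed

lemma elem_sym_0 [simp]: "elem_sym n 0 = 1"
  by (simp add: elem_sym_eq_esym esym_0)

lemma elem_sym_gt [simp]: "n < r \<Longrightarrow> elem_sym n r = 0"
  by (simp add: elem_sym_eq_esym esym_eq_0)

lemma elem_sym_Suc:
  "elem_sym (Suc n) (Suc r) = elem_sym n (Suc r) + mvar (Suc n) * elem_sym n r"
  by (simp add: elem_sym_eq_esym esym_insert atLeastAtMostSuc_conv)

lemma elem_sym_span: "elem_sym n r \<in> mp.span (mmon ` {t \<in> expos n. mon_degree t = r})"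
proof (induction n arbitrary: r)
  case 0
  show ?case
    by (cases r) (auto simp: mp.span_zero expos_0 intro!: mp.span_base)
next
  case (Suc n)
  show ?case
  proof (cases r)
    case 0
    then show ?thesis
      by (auto intro!: mp.span_base image_eqI[of _ _ 0])
  next
    case (Suc r')
    have "elem_sym n (Suc r') \<in> mp.span (mmon ` {t \<in> expos (Suc n). mon_degree t = r})"
    proof -
      have "mmon ` {t \<in> expos n. mon_degree t = r} \<subseteq> mmon ` {t \<in> expos (Suc n). mon_degree t = r}"
        using expos_mono[of n "Suc n"] by auto
      then show ?thesis
        using Suc.IH[of r] mp.span_mono Suc by blast
    qed
    moreover have "mvar (Suc n) * elem_sym n r'
        \<in> mp.span (mmon ` {t \<in> expos (Suc n). mon_degree t = r})"
    proof (rule span_mult_closed[OF _ Suc.IH])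
      fix p assume "p \<in> mmon ` {t \<in> expos n. mon_degree t = r'}"
      then obtain t where "t \<in> expos n" "mon_degree t = r'" "p = mmon t"
        by auto
      then show "mvar (Suc n) * p \<in> mp.span (mmon ` {t \<in> expos (Suc n). mon_degree t = r})"
        using expos_mono[of n "Suc n"] Suc
        by (auto simp: mvar_eq_mmon mmon_mult intro!: mp.span_base imageI expos_add expos_single)
    qed
    ultimately show ?thesis
      unfolding Suc elem_sym_Suc by (rule mp.span_add)
  qed
qed

section \<open>A spanning set of monomials\<close>

text \<open>Generators together with their degrees; the degree is recorded because the generator may
  be zero, namely \<open>elem_sym n r\<close> for \<open>n < r\<close>.\<close>

definition gens :: "nat \<Rightarrow> nat \<Rightarrow> nat \<Rightarrow> (nat \<times> mpoly) set" where
  "gens n k s = (\<lambda>i. (k, mvar i ^ k)) ` {1..n} \<union> (\<lambda>r. (r, elem_sym n r)) ` {r. n < r + s}"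

text \<open>As the generators are homogeneous, the span of \<open>igens n k s d\<close> is the
  degree \<open>d\<close> part of the ideal that they generate.\<close>

definition igens :: "nat \<Rightarrow> nat \<Rightarrow> nat \<Rightarrow> nat \<Rightarrow> mpoly set" where
  "igens n k s d = {mmon t * g | t e g. t \<in> expos n \<and> (e, g) \<in> gens n k s \<and> mon_degree t + e = d}"

text \<open>The exponent \<open>i\<close> of the last variable selects a layer, and the layer fixes
  the parameters for the remaining variables. In no variables with \<open>s > 0\<close> the ideal
  contains \<open>elem_sym 0 0 = 1\<close>, hence the empty set. The subtraction
  \<open>s - 1\<close> occurs only for \<open>i < s\<close> and does not truncate.\<close>

fun stairs :: "nat \<Rightarrow> nat \<Rightarrow> nat \<Rightarrow> (nat \<Rightarrow>\<^sub>0 nat) set" where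
  "stairs 0 k s = (if s = 0 then {0} else {})"
| "stairs (Suc n) k s = (\<lambda>(i, t). Poly_Mapping.single (Suc n) i + t) `
     (SIGMA i:{..<k}. stairs n k (if i < s then s - 1 else s))"

lemma finite_stairs [simp]: "finite (stairs n k s)"
  by (induction n arbitrary: s) auto

lemma stairs_expos: "stairs n k s \<subseteq> expos n"
proof (induction n arbitrary: s)
  case (Suc n)
  show ?case
    using Suc expos_mono[of n "Suc n"] by (force intro!: expos_add expos_single)
qed auto

lemma igensI:
  "t \<in> expos n \<Longrightarrow> (e, g) \<in> gens n k s \<Longrightarrow> mon_degree t + e = d \<Longrightarrow> mmon t * g \<in> igens n k s d"
  unfolding igens_def by blast

lemma mmon_mult_elem_sym_span:
  assumes "\<And>v. v \<in> expos n \<Longrightarrow> mon_degree v = mon_degree u + r \<Longrightarrow> q * mmon v \<in> mp.span T"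
    "u \<in> expos n"
  shows "q * (mmon u * elem_sym n r) \<in> mp.span T"
proof -
  have "(q * mmon u) * elem_sym n r \<in> mp.span T"
  proof (rule span_mult_closed[OF _ elem_sym_span])
    fix p assume "p \<in> mmon ` {t \<in> expos n. mon_degree t = r}"
    then show "q * mmon u * p \<in> mp.span T"
      using assms by (auto simp: mult.assoc mmon_mult expos_add)
  qed
  then show ?thesis
    by (simp add: mult.assoc)
qed

text \<open>Since \<open>e\<^sub>r(x\<^sub>1,\<dots>,x\<^sub>n) \<equiv> - x\<^sub>n\<^sub>+\<^sub>1 e\<^sub>r\<^sub>-\<^sub>1(x\<^sub>1,\<dots>,x\<^sub>n)\<close> modulo the ideal, a power of
  \<open>x\<^sub>n\<^sub>+\<^sub>1\<close> can be traded for a higher degree of the elementary symmetric polynomial in the first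
  \<open>n\<close> variables, until that polynomial vanishes.\<close>

lemma last_var_power_elem_sym:
  assumes "u \<in> expos n" "Suc n \<le> r + j" "Suc n \<le> r + s"
  shows "mvar (Suc n) ^ j * (mmon u * elem_sym n r) \<in> mp.span (igens (Suc n) k s (j + mon_degree u + r))"
  using assms(2,3)
proof (induction j arbitrary: r)
  case 0
  then show ?case
    by (simp add: mp.span_zero)
next
  case (Suc j)
  let ?x = "mvar (Suc n)" and ?S = "mp.span (igens (Suc n) k s (Suc j + mon_degree u + r))"
  have "mmon (Poly_Mapping.single (Suc n) j + u) * elem_sym (Suc n) (Suc r) \<in> ?S"
    using Suc.prems assms(1) expos_mono[of n "Suc n"]
    by (intro mp.span_base igensI[where e = "Suc r"])
       (auto simp: gens_def intro!: expos_add expos_single)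
  then have "?x ^ j * (mmon u * elem_sym (Suc n) (Suc r)) \<in> ?S"
    by (simp add: mvar_power mmon_mult mult.assoc flip: mmon_mult)
  moreover have "?x ^ j * (mmon u * elem_sym n (Suc r)) \<in> ?S"
    using Suc.IH[of "Suc r"] Suc.prems by simp
  moreover have "?x ^ Suc j * (mmon u * elem_sym n r)
      = ?x ^ j * (mmon u * elem_sym (Suc n) (Suc r)) - ?x ^ j * (mmon u * elem_sym n (Suc r))"
    by (simp add: elem_sym_Suc algebra_simps)
  ultimately show ?case
    by (simp only: mp.span_diff)
qed

definition hspan :: "nat \<Rightarrow> nat \<Rightarrow> nat \<Rightarrow> nat \<Rightarrow> mpoly set" where
  "hspan n k s d = mp.span (igens n k s d \<union> mmon ` {t \<in> stairs n k s. mon_degree t = d})"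

lemma igens_subset_hspan: "mp.span (igens n k s d) \<subseteq> hspan n k s d"
  unfolding hspan_def by (rule mp.span_mono) simp

text \<open>Descending induction on the exponent \<open>i\<close>: powers from \<open>k\<close> on
  lie in the ideal, and an error term divisible by a higher power of the last variable is already
  dealt with. It remains to lift a relation among the first \<open>n\<close> variables, with the
  parameter of the layer, to \<open>n + 1\<close> variables modulo such error terms.
  \<open>IH\<close> ranges over all \<open>s\<close> because the layer uses \<open>s\<close> or
  \<open>s - 1\<close>.\<close>

lemma last_var_power_hspan:
  assumes IH: "\<And>s u. u \<in> expos n \<Longrightarrow> mmon u \<in> hspan n k s (mon_degree u)"
    and "u \<in> expos n"
  shows "mvar (Suc n) ^ i * mmon u \<in> hspan (Suc n) k s (i + mon_degree u)"
  using assms(2)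
proof (induction "k - i" arbitrary: i u)
  case 0
  then have eq: "mvar (Suc n) ^ i * mmon u
      = mmon (Poly_Mapping.single (Suc n) (i - k) + u) * mvar (Suc n) ^ k"
    by (simp add: mvar_power mmon_mult algebra_simps flip: single_add)
  have "mvar (Suc n) ^ i * mmon u \<in> igens (Suc n) k s (i + mon_degree u)"
    unfolding eq using 0 expos_mono[of n "Suc n"]
    by (intro igensI[where e = k]) (auto simp: gens_def intro!: expos_add expos_single)
  then show ?case
    using igens_subset_hspan mp.span_base by blast
next
  case (Suc m)
  let ?x = "mvar (Suc n)" and ?d = "i + mon_degree u"
  let ?s = "if i < s then s - 1 else s"
  have "i < k"
    using Suc.hyps by simp
  have next_pow: "?x ^ Suc i * mmon v \<in> hspan (Suc n) k s (Suc i + mon_degree v)"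
    if "v \<in> expos n" for v
    using Suc.hyps(1)[of "Suc i" v] Suc.hyps(2) that by simp
  have u: "mmon u \<in> hspan n k ?s (mon_degree u)"
    using IH Suc.prems .
  show ?case
    unfolding hspan_def
  proof (rule span_mult_closed[OF _ u[unfolded hspan_def]], fold hspan_def)
    fix p assume "p \<in> igens n k ?s (mon_degree u) \<union> mmon ` {t \<in> stairs n k ?s. mon_degree t = mon_degree u}"
    then consider t where "t \<in> stairs n k ?s" "mon_degree t = mon_degree u" "p = mmon t"
      | t j where "t \<in> expos n" "j \<in> {1..n}" "mon_degree t + k = mon_degree u" "p = mmon t * mvar j ^ k"
      | t r where "t \<in> expos n" "n < r + ?s" "mon_degree t + r = mon_degree u" "p = mmon t * elem_sym n r"
      unfolding igens_def gens_def by fastforce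
    then show "?x ^ i * p \<in> hspan (Suc n) k s ?d"
    proof cases
      case 1
      then show ?thesis
        using \<open>i < k\<close> unfolding hspan_def
        by (intro mp.span_base) (force simp: mvar_power mmon_mult)
    next
      case 2
      have "?x ^ i * p = mmon (Poly_Mapping.single (Suc n) i + t) * mvar j ^ k"
        by (simp add: 2 mvar_power mult.assoc flip: mmon_mult)
      also have "\<dots> \<in> igens (Suc n) k s ?d"
        using 2 expos_mono[of n "Suc n"]
        by (intro igensI[where e = k]) (auto simp: gens_def intro!: expos_add expos_single)
      finally show ?thesis
        using igens_subset_hspan mp.span_base by blast
    next
      case 3
      show ?thesis
      \<comment> \<open>If the inequality holds, \<open>elem_sym (Suc n) r\<close> is a generator
        and differs from \<open>elem_sym n r\<close> by a multiple of the last variable, which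
        \<open>next_pow\<close> absorbs. It fails only for \<open>s \<le> i\<close> and
        \<open>r + s = n + 1\<close>; this is the extra relation of the high layers, which holds
        without error terms.\<close>
      proof (cases "Suc n < r + s")
        case True
        have "mmon (Poly_Mapping.single (Suc n) i + t) * elem_sym (Suc n) r \<in> igens (Suc n) k s ?d"
          using 3 True expos_mono[of n "Suc n"]
          by (intro igensI[where e = r]) (auto simp: gens_def intro!: expos_add expos_single)
        then have 4: "?x ^ i * (mmon t * elem_sym (Suc n) r) \<in> hspan (Suc n) k s ?d"
          using igens_subset_hspan mp.span_base
          by (fastforce simp: mvar_power mult.assoc simp flip: mmon_mult)
        show ?thesis
        proof (cases r)
          case 0
          then show ?thesis
            using 4 3 by simp
        next
          case (Suc r')
          have 5: "?x ^ Suc i * (mmon t * elem_sym n r') \<in> hspan (Suc n) k s ?d"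
            unfolding hspan_def
          proof (rule mmon_mult_elem_sym_span[OF _ \<open>t \<in> expos n\<close>], fold hspan_def)
            fix v assume "v \<in> expos n" "mon_degree v = mon_degree t + r'"
            moreover have "Suc i + (mon_degree t + r') = ?d"
              using 3 Suc by simp
            ultimately show "?x ^ Suc i * mmon v \<in> hspan (Suc n) k s ?d"
              using next_pow[of v] by metis
          qed
          have eq: "?x ^ i * p = ?x ^ i * (mmon t * elem_sym (Suc n) r)
              - ?x ^ Suc i * (mmon t * elem_sym n r')"
            by (simp add: 3 Suc elem_sym_Suc algebra_simps)
          show ?thesis
            unfolding eq using 4 5 mp.span_diff unfolding hspan_def by blast
        qed
      next
        case False
        have "s \<le> i"
          using 3(2) False by (intro leI notI) simp
        moreover have "Suc n \<le> r + s"
          using 3(2) \<open>s \<le> i\<close> by simp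
        ultimately have "?x ^ i * p \<in> mp.span (igens (Suc n) k s ?d)"
          using last_var_power_elem_sym[of t n r i s k] 3(1,3,4) by (simp add: add.assoc)
        then show ?thesis
          using igens_subset_hspan by blast
      qed
    qed
  qed
qed

theorem mmon_mem_hspan: "t \<in> expos n \<Longrightarrow> mmon t \<in> hspan n k s (mon_degree t)"
proof (induction n arbitrary: s t)
  case 0
  then have "t = 0"
    by (simp add: expos_0)
  show ?case
  proof (cases "s = 0")
    case True
    then show ?thesis
      using \<open>t = 0\<close> by (auto simp: hspan_def intro!: mp.span_base)
  next
    case False
    then have "mmon 0 * elem_sym 0 0 \<in> igens 0 k s 0"
      by (intro igensI[where e = 0]) (auto simp: gens_def)
    then show ?thesis
      using \<open>t = 0\<close> by (auto simp: hspan_def intro!: mp.span_base)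
  qed
next
  case (Suc n)
  obtain i u where "u \<in> expos n" "t = Poly_Mapping.single (Suc n) i + u"
    using expos_Suc_split[OF Suc.prems] .
  then show ?case
    using last_var_power_hspan[of n k u i s] Suc.IH by (simp add: mvar_power mmon_mult)
qed

section \<open>Evaluation at points\<close>

definition mon_eval :: "(nat \<Rightarrow> rat) \<Rightarrow> (nat \<Rightarrow>\<^sub>0 nat) \<Rightarrow> rat" where
  "mon_eval y t = (\<Prod>i\<in>Poly_Mapping.keys t. y i ^ Poly_Mapping.lookup t i)"

definition mp_eval :: "(nat \<Rightarrow> rat) \<Rightarrow> mpoly \<Rightarrow> rat" where
  "mp_eval y p = (\<Sum>t\<in>Poly_Mapping.keys p. Poly_Mapping.lookup p t * mon_eval y t)"

lemma mon_eval_superset: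
  assumes "finite A" "Poly_Mapping.keys t \<subseteq> A"
  shows "mon_eval y t = (\<Prod>i\<in>A. y i ^ Poly_Mapping.lookup t i)"
  unfolding mon_eval_def using assms
  by (intro prod.mono_neutral_left) (auto simp: in_keys_iff)

lemma mon_eval_add: "mon_eval y (s + t) = mon_eval y s * mon_eval y t"
proof -
  let ?A = "Poly_Mapping.keys s \<union> Poly_Mapping.keys t"
  have "Poly_Mapping.keys (s + t) \<subseteq> ?A"
    by (rule Poly_Mapping.keys_add)
  then show ?thesis
    by (simp add: mon_eval_superset[of ?A] lookup_add power_add prod.distrib)
qed

lemma mp_eval_superset:
  assumes "finite A" "Poly_Mapping.keys p \<subseteq> A"
  shows "mp_eval y p = (\<Sum>t\<in>A. Poly_Mapping.lookup p t * mon_eval y t)"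
  unfolding mp_eval_def using assms
  by (intro sum.mono_neutral_left) (auto simp: in_keys_iff)

lemma mp_eval_add: "mp_eval y (p + q) = mp_eval y p + mp_eval y q"
proof -
  let ?A = "Poly_Mapping.keys p \<union> Poly_Mapping.keys q"
  have "Poly_Mapping.keys (p + q) \<subseteq> ?A"
    by (rule Poly_Mapping.keys_add)
  then show ?thesis
    by (simp add: mp_eval_superset[of ?A] lookup_add distrib_right sum.distrib)
qed

lemma mp_eval_0 [simp]: "mp_eval y 0 = 0"
  by (simp add: mp_eval_def)

lemma mp_eval_scale: "mp_eval y (mconst c * p) = c * mp_eval y p"
proof -
  have "Poly_Mapping.keys (mconst c * p) \<subseteq> Poly_Mapping.keys p"
    by (auto simp: in_keys_iff)
  then show ?thesis
    by (simp add: mp_eval_superset[of "Poly_Mapping.keys p"] sum_distrib_left mult.assoc)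
qed

lemma mp_eval_uminus: "mp_eval y (- p) = - mp_eval y p"
  using mp_eval_scale[of y "-1" p] by (simp add: mconst_uminus)

lemma mp_eval_diff: "mp_eval y (p - q) = mp_eval y p - mp_eval y q"
  using mp_eval_add[of y p "- q"] by (simp add: mp_eval_uminus)

lemma mp_eval_sum: "mp_eval y (sum f A) = (\<Sum>a\<in>A. mp_eval y (f a))"
  by (induction A rule: infinite_finite_induct) (simp_all add: mp_eval_add)

lemma mp_eval_mmon [simp]: "mp_eval y (mmon t) = mon_eval y t"
  by (simp add: mp_eval_def mmon_def)

lemma mp_eval_mult: "mp_eval y (p * q) = mp_eval y p * mp_eval y q"
proof -
  have mon: "mp_eval y (mmon s * q) = mon_eval y s * mp_eval y q" for s q
  proof -
    have "mp_eval y (mmon s * q) = mp_eval y (\<Sum>t\<in>Poly_Mapping.keys q.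
        mconst (Poly_Mapping.lookup q t) * mmon (s + t))"
      by (subst mpoly_as_sum[of q]) (simp add: sum_distrib_left mult_ac flip: mmon_mult)
    then show ?thesis
      by (simp add: mp_eval_sum mp_eval_scale mon_eval_add mp_eval_def[of y q] sum_distrib_left mult_ac)
  qed
  have "mp_eval y (p * q) = mp_eval y (\<Sum>t\<in>Poly_Mapping.keys p.
      mconst (Poly_Mapping.lookup p t) * (mmon t * q))"
    by (subst mpoly_as_sum[of p]) (simp add: sum_distrib_right mult.assoc)
  then show ?thesis
    unfolding mp_eval_sum mp_eval_scale mon mp_eval_def[of y p] sum_distrib_right
    by (simp add: mult_ac)
qed

lemma mp_eval_1 [simp]: "mp_eval y 1 = 1"
  using mp_eval_mmon[of y 0] by (simp add: mon_eval_def)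

lemma mp_eval_mconst [simp]: "mp_eval y (mconst c) = c"
  using mp_eval_scale[of y c 1] by simp

lemma mp_eval_mvar [simp]: "mp_eval y (mvar i) = y i"
  by (simp add: mvar_eq_mmon mon_eval_def)

lemma mp_eval_prod: "mp_eval y (prod f A) = (\<Prod>a\<in>A. mp_eval y (f a))"
  by (induction A rule: infinite_finite_induct) (simp_all add: mp_eval_mult)

lemma mp_eval_elem_sym: "mp_eval y (elem_sym n r) = esym y {1..n} r"
  by (simp add: elem_sym_def esym_def mp_eval_sum mp_eval_prod)

section \<open>Generators agree with polynomials of lower degree on the point set\<close>

definition lowspan :: "nat \<Rightarrow> nat \<Rightarrow> mpoly set" where
  "lowspan n d = mp.span (mmon ` {t \<in> expos n. mon_degree t < d})"

lemma lowspan_mono: "d \<le> e \<Longrightarrow> lowspan n d \<subseteq> lowspan n e"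
  unfolding lowspan_def by (rule mp.span_mono) auto

lemma lowspan_mmon_mult:
  assumes "u \<in> expos n" "p \<in> lowspan n d"
  shows "mmon u * p \<in> lowspan n (mon_degree u + d)"
  unfolding lowspan_def
proof (rule span_mult_closed[OF _ assms(2)[unfolded lowspan_def]])
  fix p assume "p \<in> mmon ` {t \<in> expos n. mon_degree t < d}"
  then show "mmon u * p \<in> mp.span (mmon ` {t \<in> expos n. mon_degree t < mon_degree u + d})"
    using assms(1) by (auto simp: mmon_mult intro!: mp.span_base imageI expos_add)
qed

lemma lowspan_add: "p \<in> lowspan n d \<Longrightarrow> q \<in> lowspan n d \<Longrightarrow> p + q \<in> lowspan n d"
  and lowspan_diff: "p \<in> lowspan n d \<Longrightarrow> q \<in> lowspan n d \<Longrightarrow> p - q \<in> lowspan n d"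
  and lowspan_scale: "p \<in> lowspan n d \<Longrightarrow> mconst c * p \<in> lowspan n d"
  and lowspan_0: "0 \<in> lowspan n d"
  unfolding lowspan_def
  by (rule mp.span_add mp.span_diff mp.span_scale mp.span_zero; assumption?)+

lemma elem_sym_lowspan: "elem_sym n r \<in> lowspan n (Suc r)"
  using elem_sym_span[of n r] unfolding lowspan_def
  by (rule rev_subsetD) (rule mp.span_mono, auto)

text \<open>The product vanishes at every point whose coordinate \<open>i\<close> is one of
  \<open>0, ..., k - 1\<close>, so there the power takes the values of this difference of lower
  degree.\<close>

lemma mvar_power_lowspan:
  assumes "i \<in> {1..n}"
  shows "mvar i ^ k - (\<Prod>j<k. mvar i - mconst (of_nat j)) \<in> lowspan n k"
proof (induction k)
  case 0
  show ?case
    by (simp add: lowspan_0)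
next
  case (Suc k)
  let ?P = "\<Prod>j<k. mvar i - mconst (of_nat j)"
  have "mvar i * (mvar i ^ k - ?P) \<in> lowspan n (Suc k)"
    using lowspan_mmon_mult[OF expos_single[OF assms, of 1] Suc.IH] by (simp add: mvar_eq_mmon)
  moreover have "mvar i ^ k \<in> lowspan n (Suc k)"
    using expos_single[OF assms] by (auto simp: mvar_power lowspan_def intro!: mp.span_base imageI)
  then have "?P \<in> lowspan n (Suc k)"
    using Suc.IH lowspan_mono[of k "Suc k" n] lowspan_diff[of "mvar i ^ k" n "Suc k" "mvar i ^ k - ?P"]
    by auto
  moreover have "mvar i ^ Suc k - (\<Prod>j<Suc k. mvar i - mconst (of_nat j))
      = mvar i * (mvar i ^ k - ?P) + mconst (of_nat k) * ?P"
    by (simp add: algebra_simps)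
  ultimately show ?case
    using lowspan_add lowspan_scale by metis
qed

text \<open>The coefficients of \<open>(\<Prod>i=1..n. 1 + x\<^sub>i q) / (\<Prod>l<j. 1 + l q)\<close>.\<close>

fun esym_shift :: "nat \<Rightarrow> nat \<Rightarrow> nat \<Rightarrow> mpoly" where
  "esym_shift n 0 r = elem_sym n r"
| "esym_shift n (Suc j) 0 = 1"
| "esym_shift n (Suc j) (Suc r) = esym_shift n j (Suc r) - mconst (of_nat j) * esym_shift n (Suc j) r"

text \<open>Dividing by \<open>1 + j q\<close> with a constant \<open>j\<close> adds to each
  coefficient only constant multiples of earlier coefficients, which have lower degree in the
  variables.\<close>

lemma elem_sym_minus_esym_shift: "elem_sym n r - esym_shift n j r \<in> lowspan n r"
proof (induction n j r rule: esym_shift.induct)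
  case (3 n j r)
  have "esym_shift n (Suc j) r = elem_sym n r - (elem_sym n r - esym_shift n (Suc j) r)"
    by simp
  then have "esym_shift n (Suc j) r \<in> lowspan n (Suc r)"
    using 3(2) lowspan_mono[of r "Suc r" n] lowspan_diff[OF elem_sym_lowspan]
    by (metis lessI less_imp_le_nat subsetD)
  moreover have "elem_sym n (Suc r) - esym_shift n (Suc j) (Suc r)
      = (elem_sym n (Suc r) - esym_shift n j (Suc r)) + mconst (of_nat j) * esym_shift n (Suc j) r"
    by simp
  ultimately show ?case
    using 3(1) lowspan_add lowspan_scale by metis
qed (simp_all add: lowspan_0)

text \<open>The factor \<open>1 + l q\<close> is the one contributed by the variable with index
  \<open>a l\<close>, so each division removes that variable from the product.\<close>

lemma mp_eval_esym_shift:
  assumes "\<And>l. l < j \<Longrightarrow> a l \<in> {1..n} \<and> y (a l) = of_nat l"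
  shows "mp_eval y (esym_shift n j r) = esym y ({1..n} - a ` {..<j}) r"
  using assms
proof (induction n j r rule: esym_shift.induct)
  case (1 n r)
  then show ?case
    by (simp add: mp_eval_elem_sym)
next
  case (2 n j)
  then show ?case
    by (simp add: esym_0)
next
  case (3 n j r)
  let ?A = "{1..n} - a ` {..<Suc j}"
  \<comment> \<open>The indices \<open>a l\<close> are distinct because \<open>y\<close> takes
    distinct values at them.\<close>
  have "a j \<notin> a ` {..<j}"
    using 3(3) by (metis imageE lessThan_iff less_SucI less_irrefl lessI of_nat_eq_iff)
  then have eq: "{1..n} - a ` {..<j} = insert (a j) ?A"
    using 3(3)[of j] by (auto simp: lessThan_Suc)
  have "esym y (insert (a j) ?A) (Suc r) = esym y ?A (Suc r) + of_nat j * esym y ?A r"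
    using 3(3)[of j] by (subst esym_insert) auto
  then show ?case
    using 3 eq by (simp add: mp_eval_diff mp_eval_scale)
qed

definition surj_point :: "nat \<Rightarrow> nat \<Rightarrow> (nat \<Rightarrow> rat) \<Rightarrow> bool" where
  "surj_point n k y \<longleftrightarrow> y ` {1..n} = of_nat ` {..<k}"

text \<open>The two inclusions in \<open>surj_point\<close> serve the two kinds of generators.
  Coordinates below \<open>k\<close> make the product behind \<open>x_i^k\<close> vanish; the
  occurrence of every value below \<open>k\<close> lets \<open>k\<close> variables cancel, and only
  \<open>n - k < e\<close> remain.\<close>

lemma gens_agree_lowspan:
  assumes "(e, g) \<in> gens n k k"
  obtains h where "h \<in> lowspan n e" "\<And>y. surj_point n k y \<Longrightarrow> mp_eval y g = mp_eval y h"
proof -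
  from assms consider i where "i \<in> {1..n}" "e = k" "g = mvar i ^ k"
    | "n < e + k" "g = elem_sym n e"
    by (auto simp: gens_def)
  then show thesis
  proof cases
    case 1
    show thesis
    proof (rule that[of "mvar i ^ k - (\<Prod>j<k. mvar i - mconst (of_nat j))"])
      show "mvar i ^ k - (\<Prod>j<k. mvar i - mconst (of_nat j)) \<in> lowspan n e"
        using mvar_power_lowspan 1 by simp
      fix y assume "surj_point n k y"
      then have "y i \<in> of_nat ` {..<k}"
        using 1 unfolding surj_point_def by blast
      then have "(\<Prod>j<k. y i - of_nat j) = 0"
        by auto
      then show "mp_eval y g = mp_eval y (mvar i ^ k - (\<Prod>j<k. mvar i - mconst (of_nat j)))"
        using 1 by (simp add: mp_eval_diff mp_eval_prod)
    qed
  next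
    case 2
    show thesis
    proof (rule that[of "elem_sym n e - esym_shift n k e"])
      show "elem_sym n e - esym_shift n k e \<in> lowspan n e"
        by (rule elem_sym_minus_esym_shift)
      fix y assume y: "surj_point n k y"
      have "\<forall>l<k. \<exists>i\<in>{1..n}. y i = of_nat l"
        using y unfolding surj_point_def by (metis imageE imageI lessThan_iff)
      then obtain a where a: "\<And>l. l < k \<Longrightarrow> a l \<in> {1..n} \<and> y (a l) = of_nat l"
        by metis
      have "inj_on a {..<k}"
        using a by (intro inj_onI) (metis lessThan_iff of_nat_eq_iff)
      moreover have sub: "a ` {..<k} \<subseteq> {1..n}"
        using a by auto
      ultimately have "card ({1..n} - a ` {..<k}) = n - k" "k \<le> n"
        using card_mono[OF _ sub] by (simp_all add: card_Diff_subset card_image)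
      then have "esym y ({1..n} - a ` {..<k}) e = 0"
        using 2 by (intro esym_eq_0) auto
      then show "mp_eval y g = mp_eval y (elem_sym n e - esym_shift n k e)"
        using mp_eval_esym_shift[of k a n y e] a 2 by (simp add: mp_eval_diff)
    qed
  qed
qed

definition vanishing :: "(nat \<Rightarrow> rat) set \<Rightarrow> mpoly set" where
  "vanishing Y = {p. \<forall>y\<in>Y. mp_eval y p = 0}"

text \<open>Induction on the degree: on \<open>Y\<close> each ideal element in the degree of
  \<open>t\<close> agrees with a polynomial of smaller degree, which is spanned by the induction
  hypothesis. Only the ideal part of the assumed relation is tied to the degree of \<open>t\<close>;
  \<open>B\<close> enters as a whole.\<close>

lemma graded_spanning_imp_spanning_on_points:
  assumes Y: "\<And>y. y \<in> Y \<Longrightarrow> surj_point n k y"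
    and B: "\<And>t. t \<in> expos n \<Longrightarrow> mmon t \<in> mp.span (igens n k k (mon_degree t) \<union> mmon ` B)"
    and "t \<in> expos n"
  shows "mmon t \<in> mp.span (mmon ` B \<union> vanishing Y)"
  using assms(3)
proof (induction "mon_degree t" arbitrary: t rule: less_induct)
  case less
  let ?S = "mp.span (mmon ` B \<union> vanishing Y)"
  have low: "lowspan n (mon_degree t) \<subseteq> ?S"
    unfolding lowspan_def using less by (intro mp.span_minimal) auto
  have "igens n k k (mon_degree t) \<subseteq> ?S"
  proof
    fix p assume "p \<in> igens n k k (mon_degree t)"
    then obtain u e g where p: "p = mmon u * g" "u \<in> expos n" "(e, g) \<in> gens n k k"
      "mon_degree u + e = mon_degree t"
      unfolding igens_def by auto
    obtain h where h: "h \<in> lowspan n e" "\<And>y. surj_point n k y \<Longrightarrow> mp_eval y g = mp_eval y h"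
      using gens_agree_lowspan[OF p(3)] by blast
    have "mmon u * h \<in> ?S"
      using lowspan_mmon_mult[OF p(2) h(1)] p(4) low by auto
    moreover have "mmon u * g - mmon u * h \<in> vanishing Y"
      using h(2) Y by (simp add: vanishing_def mp_eval_diff mp_eval_mult)
    then have "mmon u * g - mmon u * h \<in> ?S"
      by (intro mp.span_base) simp
    ultimately have "(mmon u * g - mmon u * h) + mmon u * h \<in> ?S"
      by (intro mp.span_add)
    then show "p \<in> ?S"
      by (simp add: p(1))
  qed
  moreover have "mmon ` B \<subseteq> ?S"
    by (auto intro: mp.span_base)
  ultimately have "mp.span (igens n k k (mon_degree t) \<union> mmon ` B) \<subseteq> ?S"
    by (intro mp.span_minimal) auto
  then show ?case
    using B[OF less.prems] by blast
qed

section \<open>Functions on a finite point set\<close>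

interpretation fn: vector_space "\<lambda>(c::rat) (f :: (nat \<Rightarrow> rat) \<Rightarrow> rat) y. c * f y"
  by unfold_locales (auto simp: algebra_simps fun_eq_iff)

interpretation mp_fn: vector_space_pair "\<lambda>c p. mconst c * p"
    "\<lambda>(c::rat) (f :: (nat \<Rightarrow> rat) \<Rightarrow> rat) y. c * f y" ..

text \<open>Cutting off to 0 outside \<open>Y\<close> makes vanishing on \<open>Y\<close> the same
  as having image 0.\<close>

definition eval_on :: "(nat \<Rightarrow> rat) set \<Rightarrow> mpoly \<Rightarrow> (nat \<Rightarrow> rat) \<Rightarrow> rat" where
  "eval_on Y p = (\<lambda>y. if y \<in> Y then mp_eval y p else 0)"

lemma linear_eval_on:
  "Vector_Spaces.linear (\<lambda>c p. mconst c * p) (\<lambda>(c::rat) f y. c * f y) (eval_on Y)"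
  by unfold_locales (auto simp: eval_on_def mp_eval_add mp_eval_scale fun_eq_iff)

lemma mpolys_eq_span: "mpolys n = mp.span (mmon ` expos n)"
proof -
  have "p \<in> mpolys n \<longleftrightarrow> Poly_Mapping.keys p \<subseteq> expos n" for p
    by (auto simp: mpolys_def expos_def)
  then show ?thesis
    using mem_span_mmon keys_span_mmon by blast
qed

lemma mconst_mem_mpolys: "mconst c \<in> mpolys n"
  by (auto simp: mpolys_def mconst_def)

lemma mvar_mem_mpolys: "i \<in> {1..n} \<Longrightarrow> mvar i \<in> mpolys n"
  by (auto simp: mpolys_def mvar_def)

lemma mpolys_diff: "p \<in> mpolys n \<Longrightarrow> q \<in> mpolys n \<Longrightarrow> p - q \<in> mpolys n"
  using mpolys_add[of p n "- q"] mpolys_uminus by simp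

lemma mpolys_prod: "(\<And>a. a \<in> A \<Longrightarrow> f a \<in> mpolys n) \<Longrightarrow> prod f A \<in> mpolys n"
  by (induction A rule: infinite_finite_induct) (simp_all add: mpolys_1 mpolys_mult)

lemma interpolation:
  assumes "finite Y" and sep: "\<And>y z. y \<in> Y \<Longrightarrow> z \<in> Y \<Longrightarrow> y \<noteq> z \<Longrightarrow> \<exists>i\<in>{1..n}. y i \<noteq> z i"
    and "z \<in> Y"
  shows "\<exists>p\<in>mpolys n. \<forall>y\<in>Y. mp_eval y p = (if y = z then 1 else 0)"
proof -
  obtain i where i: "\<And>y. y \<in> Y - {z} \<Longrightarrow> i y \<in> {1..n} \<and> y (i y) \<noteq> z (i y)"
    using sep[OF _ \<open>z \<in> Y\<close>] by (metis DiffE insertI1)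
  \<comment> \<open>A Lagrange polynomial: each other point contributes one linear factor in a
    coordinate separating it from \<open>z\<close>, scaled to be 1 at \<open>z\<close>.\<close>
  define p where "p = (\<Prod>y\<in>Y - {z}. mconst (1 / (z (i y) - y (i y))) * (mvar (i y) - mconst (y (i y))))"
  have "p \<in> mpolys n"
    unfolding p_def using i
    by (intro mpolys_prod mpolys_mult mpolys_diff mconst_mem_mpolys mvar_mem_mpolys) auto
  moreover have "mp_eval y p = (if y = z then 1 else 0)" if "y \<in> Y" for y
  proof (cases "y = z")
    case True
    have "mp_eval z p = 1"
      unfolding p_def mp_eval_prod
    proof (intro prod.neutral ballI)
      fix w assume "w \<in> Y - {z}"
      from i[OF this] show "mp_eval z (mconst (1 / (z (i w) - w (i w))) * (mvar (i w) - mconst (w (i w)))) = 1"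
        by (simp add: mp_eval_scale mp_eval_diff)
    qed
    then show ?thesis
      using True by simp
  next
    case False
    then show ?thesis
      using \<open>finite Y\<close> that
      by (auto simp: p_def mp_eval_prod mp_eval_scale mp_eval_diff intro!: prod_zero bexI[of _ y])
  qed
  ultimately show ?thesis
    by blast
qed

text \<open>A dimension count for the functions on \<open>Y\<close>: the indicator functions of the
  points are independent, and by interpolation they come from polynomials, hence lie in the span of
  the images of the monomials in \<open>B\<close>.\<close>

lemma card_points_le:
  assumes "finite Y" "finite B"
    and sep: "\<And>y z. y \<in> Y \<Longrightarrow> z \<in> Y \<Longrightarrow> y \<noteq> z \<Longrightarrow> \<exists>i\<in>{1..n}. y i \<noteq> z i"
    and B: "\<And>t. t \<in> expos n \<Longrightarrow> mmon t \<in> mp.span (mmon ` B \<union> vanishing Y)"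
  shows "card Y \<le> card B"
proof -
  define ind :: "(nat \<Rightarrow> rat) \<Rightarrow> (nat \<Rightarrow> rat) \<Rightarrow> rat"
    where "ind = (\<lambda>z y. if y = z then 1 else 0)"
  have "ind z \<in> fn.span (eval_on Y ` (mmon ` B))" if "z \<in> Y" for z
  proof -
    obtain p where p: "p \<in> mpolys n" "\<forall>y\<in>Y. mp_eval y p = (if y = z then 1 else 0)"
      using interpolation[OF assms(1) sep \<open>z \<in> Y\<close>] by blast
    have "p \<in> mp.span (mmon ` B \<union> vanishing Y)"
    proof -
      have "mpolys n \<subseteq> mp.span (mmon ` B \<union> vanishing Y)"
        unfolding mpolys_eq_span using B by (intro mp.span_minimal) auto
      then show ?thesis
        using p(1) by blast
    qed
    then have "eval_on Y p \<in> fn.span (eval_on Y ` (mmon ` B \<union> vanishing Y))"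
      using mp_fn.linear_span_image[OF linear_eval_on] by blast
    also have "\<dots> \<subseteq> fn.span (insert 0 (eval_on Y ` (mmon ` B)))"
      by (rule fn.span_mono) (auto simp: eval_on_def vanishing_def fun_eq_iff)
    finally have "eval_on Y p \<in> fn.span (eval_on Y ` (mmon ` B))"
      by simp
    moreover have "eval_on Y p = ind z"
      using p(2) that by (intro ext) (auto simp: eval_on_def ind_def)
    ultimately show ?thesis
      by simp
  qed
  then have sub: "ind ` Y \<subseteq> fn.span (eval_on Y ` (mmon ` B))"
    by (rule image_subsetI)
  have inj: "inj ind"
  proof (rule injI)
    fix w z assume "ind w = ind z"
    then have "ind w w = ind z w"
      by simp
    then show "w = z"
      by (simp add: ind_def split: if_splits)
  qed
  have scalars_zero: "f x = 0" if "(\<Sum>v\<in>ind ` Y. (\<lambda>y. f v * v y)) = 0" "x \<in> ind ` Y" for f x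
  proof -
    from that obtain z where z: "z \<in> Y" "x = ind z" and 0: "(\<Sum>w\<in>Y. (\<lambda>y. f (ind w) * ind w y)) = 0"
      using inj by (auto simp: sum.reindex inj_on_subset)
    have "(\<Sum>w\<in>Y. (\<lambda>y. f (ind w) * ind w y)) z = (\<Sum>w\<in>Y. f (ind w) * ind w z)"
      by (induction Y rule: infinite_finite_induct) auto
    also have "\<dots> = (\<Sum>w\<in>Y. if w = z then f (ind w) else 0)"
      by (intro sum.cong) (auto simp: ind_def)
    also have "\<dots> = f (ind z)"
      using z(1) \<open>finite Y\<close> by (simp only: sum.delta if_True)
    finally have sum: "(\<Sum>w\<in>Y. (\<lambda>y. f (ind w) * ind w y)) z = f (ind z)" .
    show "f x = 0"
      using trans[OF sum[symmetric] fun_cong[OF 0, of z]] unfolding \<open>x = ind z\<close> zero_fun_apply .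
  qed
  have indep: "fn.independent (ind ` Y)"
  proof
    assume "fn.dependent (ind ` Y)"
    then obtain f x where fx: "x \<in> ind ` Y" "f x \<noteq> 0" "(\<Sum>v\<in>ind ` Y. (\<lambda>y. f v * v y)) = 0"
      unfolding fn.dependent_finite[OF finite_imageI[OF \<open>finite Y\<close>]] by (elim exE conjE bexE)
    show False
      using fx(2) scalars_zero[of f x, OF fx(3,1)] by (rule notE)
  qed
  have "finite (eval_on Y ` (mmon ` B))"
    using \<open>finite B\<close> by (intro finite_imageI)
  then have "card (ind ` Y) \<le> card (eval_on Y ` (mmon ` B))"
    by (rule fn.independent_span_bound[OF _ indep sub, THEN conjunct2])
  also have "\<dots> \<le> card B"
    using \<open>finite B\<close> card_image_le[of B "eval_on Y \<circ> mmon"] by (simp add: image_comp)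
  finally show ?thesis
    using inj by (simp add: card_image inj_on_subset)
qed

section \<open>Inversions of ordered set partitions\<close>

text \<open>\<open>U\<close> collects the letters of the blocks already passed, so each block
  contributes the inversions in which its minimum is the smaller letter.\<close>

fun list_inv :: "nat set \<Rightarrow> nat set list \<Rightarrow> nat" where
  "list_inv U [] = 0"
| "list_inv U (b # bs) = card {j \<in> U. Min b < j} + list_inv (U \<union> b) bs"

lemma list_inv_append: "list_inv U (xs @ ys) = list_inv U xs + list_inv (U \<union> \<Union> (set xs)) ys"
  by (induction xs arbitrary: U) (simp_all add: Un_assoc)

lemma list_inv_insert:
  assumes "finite U" "a \<notin> U" "\<And>b. b \<in> set bs \<Longrightarrow> finite b \<and> a \<notin> b \<and> Min b < a"
  shows "list_inv (insert a U) bs = list_inv U bs + length bs"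
  using assms
proof (induction bs arbitrary: U)
  case (Cons b bs)
  have "{j \<in> insert a U. Min b < j} = insert a {j \<in> U. Min b < j}"
    using Cons.prems(3)[of b] by auto
  then have "card {j \<in> insert a U. Min b < j} = Suc (card {j \<in> U. Min b < j})"
    using Cons.prems(1,2) by simp
  moreover have "list_inv (insert a (U \<union> b)) bs = list_inv (U \<union> b) bs + length bs"
    using Cons.prems by (intro Cons.IH) auto
  ultimately show ?case
    by simp
qed simp

text \<open>Reading from the left moves the head block into \<open>U\<close>, hence the general
  \<open>U\<close>. Distinct minima keep the inversions of the head apart from those of the later
  blocks.\<close>

lemma card_inversions_eq_list_inv:
  assumes "finite U" "\<And>b. b \<in> set bs \<Longrightarrow> finite b" "distinct (map Min bs)"
  shows "card {(i, j). i < j \<and> (\<exists>m<length bs. i = Min (bs ! m) \<and> (j \<in> U \<or> (\<exists>l<m. j \<in> bs ! l)))}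
    = list_inv U bs"
  using assms
proof (induction bs arbitrary: U)
  case (Cons b bs)
  let ?I = "\<lambda>U bs. {(i, j). i < j \<and>
    (\<exists>m<length bs. i = Min (bs ! m) \<and> (j \<in> U \<or> (\<exists>l<m. j \<in> bs ! l)))}"
  let ?J = "Pair (Min b) ` {j \<in> U. Min b < j}"
  have fin: "finite (?I V cs)" if "finite V" "\<And>c. c \<in> set cs \<Longrightarrow> finite c" for V :: "nat set" and cs
  proof (rule finite_subset)
    show "?I V cs \<subseteq> Min ` set cs \<times> (V \<union> \<Union> (set cs))"
    proof clarify
      fix j m assume "m < length cs" "j \<in> V \<or> (\<exists>l<m. j \<in> cs ! l)"
      then show "Min (cs ! m) \<in> Min ` set cs \<and> j \<in> V \<union> \<Union> (set cs)"
        by (meson UnCI UnionI imageI less_trans nth_mem)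
    qed
  qed (use that in auto)
  have mem: "(i, j) \<in> ?I U (b # bs) \<longleftrightarrow> (i, j) \<in> ?J \<or> (i, j) \<in> ?I (U \<union> b) bs" for i j
  proof -
    have "(i, j) \<in> ?I U (b # bs) \<longleftrightarrow> i < j \<and> (i = Min b \<and> j \<in> U \<or>
        (\<exists>m<length bs. i = Min (bs ! m) \<and> (j \<in> U \<or> j \<in> b \<or> (\<exists>l<m. j \<in> bs ! l))))"
      by (simp add: Ex_less_Suc2)
    moreover have "(i, j) \<in> ?J \<longleftrightarrow> i < j \<and> i = Min b \<and> j \<in> U"
      by auto
    ultimately show ?thesis
      by (simp only: mem_Collect_eq prod.case Un_iff) blast
  qed
  have split: "?I U (b # bs) = ?J \<union> ?I (U \<union> b) bs"
  proof (rule Set.set_eqI)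
    fix x show "x \<in> ?I U (b # bs) \<longleftrightarrow> x \<in> ?J \<union> ?I (U \<union> b) bs"
      using mem[of "fst x" "snd x"] unfolding prod.collapse Un_iff .
  qed
  have "?J \<inter> ?I (U \<union> b) bs = {}"
    using Cons.prems(3) by (auto dest: nth_mem)
  then have "card (?I U (b # bs)) = card ?J + card (?I (U \<union> b) bs)"
    unfolding split using Cons.prems by (intro card_Un_disjoint fin) auto
  also have "card ?J = card {j \<in> U. Min b < j}"
    by (intro card_image inj_onI) auto
  also have "card (?I (U \<union> b) bs) = list_inv (U \<union> b) bs"
    using Cons.prems by (intro Cons.IH) auto
  finally show ?case
    by simp
qed simp

section \<open>Adding and removing the largest letter of an ordered set partition\<close>

lemma OP_blocks:
  assumes "\<sigma> \<in> OP n k" "b \<in> set \<sigma>"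
  shows "finite b" "b \<noteq> {}" "b \<subseteq> {1..n}"
proof -
  show "b \<subseteq> {1..n}" "b \<noteq> {}"
    using assms by (auto simp: OP_def partition_on_def)
  then show "finite b"
    using finite_subset by blast
qed

lemma OP_block_less:
  assumes "\<sigma> \<in> OP n k" "b \<in> set \<sigma>"
  shows "finite b \<and> Suc n \<notin> b \<and> Min b < Suc n"
proof -
  have "Min b \<in> {1..n}"
    using OP_blocks[OF assms] Min_in by blast
  then show ?thesis
    using OP_blocks[OF assms] by auto
qed

lemma osp_inv_eq_list_inv:
  assumes "\<sigma> \<in> OP n k"
  shows "osp_inv \<sigma> = list_inv {} \<sigma>"
proof -
  have "inj_on Min (set \<sigma>)"
  proof (rule inj_onI)
    fix a b assume ab: "a \<in> set \<sigma>" "b \<in> set \<sigma>" "Min a = Min b"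
    then have "Min a \<in> a" "Min a \<in> b"
      using OP_blocks[OF assms] Min_in by metis+
    moreover have "a \<inter> b = {}" if "a \<noteq> b"
      using ab that assms unfolding OP_def partition_on_def disjoint_def by blast
    ultimately show "a = b"
      by blast
  qed
  then have "distinct (map Min \<sigma>)"
    using assms by (simp add: OP_def distinct_map)
  moreover have "osp_inversions \<sigma>
      = {(i, j). i < j \<and> (\<exists>m<length \<sigma>. i = Min (\<sigma> ! m) \<and> (j \<in> {} \<or> (\<exists>l<m. j \<in> \<sigma> ! l)))}"
    unfolding osp_inversions_def by blast
  ultimately show ?thesis
    using card_inversions_eq_list_inv[of "{}" \<sigma>] OP_blocks(1)[OF assms] by (simp add: osp_inv_def)
qed

text \<open>Isolates one block, whatever its position, against a partition of the complement; both
  ways of adding the letter \<open>Suc n\<close> are read off from this form.\<close>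

lemma OP_split_iff:
  "xs @ b # ys \<in> OP n (Suc k) \<longleftrightarrow> length xs + length ys = k \<and> distinct (xs @ ys) \<and>
     partition_on ({1..n} - b) (set (xs @ ys)) \<and> b \<subseteq> {1..n} \<and> b \<noteq> {}"
  (is "?L \<longleftrightarrow> ?R")
proof
  assume ?L
  then have d: "distinct (xs @ b # ys)" and p: "partition_on {1..n} (insert b (set (xs @ ys)))"
    and l: "length xs + length ys = k"
    by (auto simp: OP_def)
  have "disjnt b (\<Union> (set (xs @ ys)))"
    using p d by (fastforce simp: partition_on_def disjoint_def disjnt_def)
  then show ?R
    using partition_on_insert[of b "set (xs @ ys)" "{1..n}"] p d l by auto
next
  assume R: ?R
  then have "disjnt b (\<Union> (set (xs @ ys)))"
    by (auto simp: partition_on_def disjnt_def)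
  moreover from this have "b \<notin> set (xs @ ys)"
    using R by (auto simp: disjnt_def)
  ultimately show ?L
    using R partition_on_insert[of b "set (xs @ ys)" "{1..n}"] by (auto simp: OP_def)
qed

lemma OP_insert_max_iff:
  assumes "Suc n \<notin> b" "b \<noteq> {}"
  shows "xs @ insert (Suc n) b # ys \<in> OP (Suc n) (Suc k) \<longleftrightarrow> xs @ b # ys \<in> OP n (Suc k)"
proof -
  have "{1..Suc n} - insert (Suc n) b = {1..n} - b" "insert (Suc n) b \<subseteq> {1..Suc n} \<longleftrightarrow> b \<subseteq> {1..n}"
    using assms by (auto simp: subset_iff le_Suc_eq)
  then show ?thesis
    using assms by (simp only: OP_split_iff) auto
qed

lemma OP_singleton_max_iff:
  "xs @ {Suc n} # ys \<in> OP (Suc n) (Suc k) \<longleftrightarrow> xs @ ys \<in> OP n k"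
proof -
  have "{1..Suc n} - {Suc n} = {1..n}"
    by auto
  then show ?thesis
    unfolding OP_split_iff by (auto simp: OP_def)
qed

text \<open>The new letter joins a nonempty block, so it leaves all minima unchanged and only gains
  one inversion with each block to its right.\<close>

lemma osp_inv_insert_max:
  assumes "xs @ b # ys \<in> OP n (Suc k)"
  shows "osp_inv (xs @ insert (Suc n) b # ys) = osp_inv (xs @ b # ys) + length ys"
proof -
  note blocks = OP_blocks[OF assms]
  have b: "finite b" "b \<noteq> {}" "b \<subseteq> {1..n}"
    using blocks[of b] by auto
  then have nb: "Suc n \<notin> b" and Min: "Min (insert (Suc n) b) = Min b"
    using OP_block_less[OF assms, of b] Min_insert[of b "Suc n"] by (simp_all add: min_absorb2 del: Min_insert)
  have "finite c \<and> Suc n \<notin> c \<and> Min c < Suc n" if "c \<in> set ys" for c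
    using OP_block_less[OF assms, of c] that by simp
  moreover have "finite (\<Union> (set xs) \<union> b)" "Suc n \<notin> \<Union> (set xs) \<union> b"
    using blocks nb by fastforce+
  ultimately have "list_inv (insert (Suc n) (\<Union> (set xs) \<union> b)) ys = list_inv (\<Union> (set xs) \<union> b) ys + length ys"
    by (intro list_inv_insert)
  then have "list_inv {} (xs @ insert (Suc n) b # ys) = list_inv {} (xs @ b # ys) + length ys"
    by (simp add: list_inv_append Min)
  then show ?thesis
    using osp_inv_eq_list_inv assms OP_insert_max_iff nb b(2) by metis
qed

text \<open>As the minimum of its own block the new letter has no larger letter to its left, so
  again only the blocks to its right count.\<close>

lemma osp_inv_singleton_max:
  assumes "xs @ ys \<in> OP n k"
  shows "osp_inv (xs @ {Suc n} # ys) = osp_inv (xs @ ys) + length ys"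
proof -
  note blocks = OP_blocks[OF assms]
  have "finite c \<and> Suc n \<notin> c \<and> Min c < Suc n" if "c \<in> set ys" for c
    using OP_block_less[OF assms, of c] that by simp
  moreover have "finite (\<Union> (set xs))" "Suc n \<notin> \<Union> (set xs)"
    using blocks by fastforce+
  ultimately have "list_inv (insert (Suc n) (\<Union> (set xs))) ys = list_inv (\<Union> (set xs)) ys + length ys"
    by (intro list_inv_insert)
  moreover have "{j \<in> \<Union> (set xs). Suc n < j} = {}"
    using blocks(3) by fastforce
  then have "card {j \<in> \<Union> (set xs). Suc n < j} = 0"
    by (simp only: card.empty)
  ultimately have "list_inv {} (xs @ {Suc n} # ys) = list_inv {} (xs @ ys) + length ys"
    by (simp add: list_inv_append)
  then show ?thesis
    using osp_inv_eq_list_inv assms OP_singleton_max_iff by metis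
qed

lemma OP_0_0: "OP 0 0 = {[]}"
  by (auto simp: OP_def partition_on_def)

lemma OP_0_Suc: "OP 0 (Suc k) = {}"
proof -
  have False if "\<sigma> \<in> OP 0 (Suc k)" for \<sigma>
  proof -
    have "\<sigma> ! 0 \<in> set \<sigma>"
      using that by (simp add: OP_def)
    then show False
      using OP_blocks[OF that] by force
  qed
  then show ?thesis
    by blast
qed

lemma OP_Suc_0: "OP (Suc n) 0 = {}"
  by (auto simp: OP_def partition_on_def)

lemma finite_OP [simp]: "finite (OP n k)"
proof (rule finite_subset)
  show "OP n k \<subseteq> {\<sigma>. set \<sigma> \<subseteq> Pow {1..n} \<and> length \<sigma> = k}"
    by (auto simp: OP_def partition_on_def)
qed (intro finite_lists_length_eq, simp)

definition insert_max :: "nat \<Rightarrow> nat \<times> nat set list \<Rightarrow> nat set list" where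
  "insert_max n = (\<lambda>(l, \<sigma>). take l \<sigma> @ insert (Suc n) (\<sigma> ! l) # drop (Suc l) \<sigma>)"

definition singleton_max :: "nat \<Rightarrow> nat \<times> nat set list \<Rightarrow> nat set list" where
  "singleton_max n = (\<lambda>(l, \<sigma>). take l \<sigma> @ {Suc n} # drop l \<sigma>)"

text \<open>The block containing \<open>a\<close> marks the cut, provided that \<open>a\<close> does
  not occur earlier. With \<open>a\<close> the largest letter this recovers the place of
  insertion.\<close>

lemma append_Cons_eq_by_mem:
  assumes "xs @ b # ys = xs' @ b' # ys'" "a \<in> b" "a \<in> b'" "a \<notin> \<Union> (set xs)" "a \<notin> \<Union> (set xs')"
  shows "xs = xs' \<and> b = b' \<and> ys = ys'"
  using assms
proof (induction xs arbitrary: xs')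
  case Nil
  then show ?case
    by (cases xs') auto
next
  case (Cons x xs)
  then show ?case
    by (cases xs') auto
qed

lemma OP_max_notin: "\<sigma> \<in> OP n k \<Longrightarrow> Suc n \<notin> \<Union> (set \<sigma>)"
  using OP_blocks(3) by fastforce

lemma inj_insert_max: "inj_on (insert_max n) ({..k} \<times> OP n (Suc k))"
proof (rule inj_onI)
  fix x x'
  assume mem: "x \<in> {..k} \<times> OP n (Suc k)" "x' \<in> {..k} \<times> OP n (Suc k)" and "insert_max n x = insert_max n x'"
  moreover obtain l \<sigma> l' \<sigma>' where x: "x = (l, \<sigma>)" "x' = (l', \<sigma>')"
    by (metis surj_pair)
  ultimately have eq: "insert_max n (l, \<sigma>) = insert_max n (l', \<sigma>')"
    and \<sigma>: "\<sigma> \<in> OP n (Suc k)" "\<sigma>' \<in> OP n (Suc k)" and "l \<in> {..k}" "l' \<in> {..k}"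
    by auto
  then have l: "l < length \<sigma>" "l' < length \<sigma>'"
    by (auto simp: OP_def)
  have notin: "Suc n \<notin> \<Union> (set \<sigma>)" "Suc n \<notin> \<Union> (set \<sigma>')"
    using OP_max_notin \<sigma> by auto
  then have 1: "Suc n \<notin> \<Union> (set (take l \<sigma>))" "Suc n \<notin> \<Union> (set (take l' \<sigma>'))"
    "Suc n \<notin> \<sigma> ! l" "Suc n \<notin> \<sigma>' ! l'"
    using l by (auto dest: in_set_takeD)
  have parts: "take l \<sigma> = take l' \<sigma>' \<and> insert (Suc n) (\<sigma> ! l) = insert (Suc n) (\<sigma>' ! l')
      \<and> drop (Suc l) \<sigma> = drop (Suc l') \<sigma>'"
    using eq 1 unfolding insert_max_def prod.case by (intro append_Cons_eq_by_mem) auto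
  then have "l = l'"
    using l by (metis length_take min.absorb4)
  moreover have "\<sigma> ! l = \<sigma>' ! l'"
    using parts 1 by (metis insert_ident)
  ultimately show "x = x'"
    unfolding x
    using parts l by (metis id_take_nth_drop)
qed

lemma inj_singleton_max: "inj_on (singleton_max n) ({..k} \<times> OP n k)"
proof (rule inj_onI)
  fix x x'
  assume mem: "x \<in> {..k} \<times> OP n k" "x' \<in> {..k} \<times> OP n k" and "singleton_max n x = singleton_max n x'"
  moreover obtain l \<sigma> l' \<sigma>' where x: "x = (l, \<sigma>)" "x' = (l', \<sigma>')"
    by (metis surj_pair)
  ultimately have eq: "singleton_max n (l, \<sigma>) = singleton_max n (l', \<sigma>')"
    and \<sigma>: "\<sigma> \<in> OP n k" "\<sigma>' \<in> OP n k" and "l \<in> {..k}" "l' \<in> {..k}"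
    by auto
  then have l: "l \<le> length \<sigma>" "l' \<le> length \<sigma>'"
    by (auto simp: OP_def)
  have "Suc n \<notin> \<Union> (set \<sigma>)" "Suc n \<notin> \<Union> (set \<sigma>')"
    using OP_max_notin \<sigma> by auto
  then have "Suc n \<notin> \<Union> (set (take l \<sigma>))" "Suc n \<notin> \<Union> (set (take l' \<sigma>'))"
    by (auto dest: in_set_takeD)
  then have parts: "take l \<sigma> = take l' \<sigma>' \<and> {Suc n} = {Suc n} \<and> drop l \<sigma> = drop l' \<sigma>'"
    using eq unfolding singleton_max_def prod.case by (intro append_Cons_eq_by_mem) auto
  then have "l = l'"
    using l by (metis length_take min.absorb2)
  then show "x = x'"
    unfolding x
    using parts by (metis append_take_drop_id)
qed

lemma insert_max_props:
  assumes "l \<le> k" "\<sigma> \<in> OP n (Suc k)"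
  shows "insert_max n (l, \<sigma>) \<in> OP (Suc n) (Suc k)"
    "osp_inv (insert_max n (l, \<sigma>)) = osp_inv \<sigma> + (k - l)"
    "{Suc n} \<notin> set (insert_max n (l, \<sigma>))"
proof -
  have len: "length \<sigma> = Suc k"
    using assms(2) by (simp add: OP_def)
  then have \<sigma>: "\<sigma> = take l \<sigma> @ \<sigma> ! l # drop (Suc l) \<sigma>" and mem: "\<sigma> ! l \<in> set \<sigma>"
    using assms(1) by (auto intro!: id_take_nth_drop)
  have ne: "\<sigma> ! l \<noteq> {}" "Suc n \<notin> \<sigma> ! l" "Suc n \<notin> \<Union> (set \<sigma>)"
    using OP_blocks[OF assms(2) mem] OP_max_notin[OF assms(2)] by auto
  show "insert_max n (l, \<sigma>) \<in> OP (Suc n) (Suc k)"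
    unfolding insert_max_def prod.case OP_insert_max_iff[OF ne(2,1)] using \<sigma> assms(2) by simp
  show "osp_inv (insert_max n (l, \<sigma>)) = osp_inv \<sigma> + (k - l)"
    unfolding insert_max_def prod.case
    using osp_inv_insert_max[of "take l \<sigma>" "\<sigma> ! l" "drop (Suc l) \<sigma>" n k] \<sigma> assms(2) len by simp
  have "{Suc n} \<notin> set \<sigma>" "{Suc n} \<noteq> insert (Suc n) (\<sigma> ! l)"
    using ne by auto
  then show "{Suc n} \<notin> set (insert_max n (l, \<sigma>))"
    unfolding insert_max_def by (auto dest: in_set_takeD in_set_dropD)
qed

lemma singleton_max_props:
  assumes "l \<le> k" "\<sigma> \<in> OP n k"
  shows "singleton_max n (l, \<sigma>) \<in> OP (Suc n) (Suc k)"
    "osp_inv (singleton_max n (l, \<sigma>)) = osp_inv \<sigma> + (k - l)"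
    "{Suc n} \<in> set (singleton_max n (l, \<sigma>))"
proof -
  have len: "length \<sigma> = k"
    using assms(2) by (simp add: OP_def)
  show "singleton_max n (l, \<sigma>) \<in> OP (Suc n) (Suc k)"
    using assms(2) by (simp add: singleton_max_def OP_singleton_max_iff)
  show "osp_inv (singleton_max n (l, \<sigma>)) = osp_inv \<sigma> + (k - l)"
    using osp_inv_singleton_max[of "take l \<sigma>" "drop l \<sigma>" n k] assms(2) len
    by (simp add: singleton_max_def)
  show "{Suc n} \<in> set (singleton_max n (l, \<sigma>))"
    by (simp add: singleton_max_def)
qed

text \<open>The range of \<open>l\<close> is \<open>{..k}\<close> in both cases: there are
  \<open>k + 1\<close> blocks to join, and \<open>k + 1\<close> gaps around \<open>k\<close> blocks
  for a new singleton.\<close>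

lemma OP_Suc_Suc:
  "OP (Suc n) (Suc k) = insert_max n ` ({..k} \<times> OP n (Suc k)) \<union> singleton_max n ` ({..k} \<times> OP n k)"
proof (intro equalityI subsetI)
  fix \<tau> assume \<tau>: "\<tau> \<in> OP (Suc n) (Suc k)"
  then have "Suc n \<in> \<Union> (set \<tau>)"
    by (auto simp: OP_def partition_on_def)
  then obtain b xs ys where b: "Suc n \<in> b" and eq: "\<tau> = xs @ b # ys"
    by (metis UnionE split_list)
  have len: "length xs \<le> k"
    using \<tau> eq by (simp add: OP_def)
  show "\<tau> \<in> insert_max n ` ({..k} \<times> OP n (Suc k)) \<union> singleton_max n ` ({..k} \<times> OP n k)"
  proof (cases "b = {Suc n}")
    case True
    then have "xs @ ys \<in> OP n k"
      using \<tau> eq OP_singleton_max_iff by metis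
    moreover have "\<tau> = singleton_max n (length xs, xs @ ys)"
      using True eq by (simp add: singleton_max_def)
    ultimately show ?thesis
      using len by blast
  next
    case False
    then have ins: "insert (Suc n) (b - {Suc n}) = b" "b - {Suc n} \<noteq> {}"
      using b by auto
    then have "xs @ (b - {Suc n}) # ys \<in> OP n (Suc k)"
      using \<tau> eq OP_insert_max_iff[of n "b - {Suc n}" xs ys k] by simp
    moreover have "\<tau> = insert_max n (length xs, xs @ (b - {Suc n}) # ys)"
      using ins eq by (simp add: insert_max_def nth_append)
    ultimately show ?thesis
      using len by blast
  qed
qed (use insert_max_props(1) singleton_max_props(1) in auto)

text \<open>General in \<open>f\<close> to serve three recursions: for the number of partitions, for
  inversions and for coinversions. Insertion at position \<open>l\<close> creates
  \<open>k - l\<close> inversions, and the sum over \<open>l\<close> is then reversed.\<close>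

lemma sum_OP_Suc_Suc:
  fixes f :: "nat \<Rightarrow> 'a::comm_monoid_add"
  shows "(\<Sum>\<sigma>\<in>OP (Suc n) (Suc k). f (osp_inv \<sigma>))
    = (\<Sum>l\<le>k. (\<Sum>\<sigma>\<in>OP n (Suc k). f (osp_inv \<sigma> + l)) + (\<Sum>\<sigma>\<in>OP n k. f (osp_inv \<sigma> + l)))"
proof -
  let ?A = "{..k} \<times> OP n (Suc k)" and ?B = "{..k} \<times> OP n k"
  have rev: "(\<Sum>l\<le>k. g (k - l)) = (\<Sum>l\<le>k. g l)" for g :: "nat \<Rightarrow> 'a"
    by (rule sum.reindex_bij_witness[of _ "\<lambda>l. k - l" "\<lambda>l. k - l"]) auto
  have "insert_max n ` ?A \<inter> singleton_max n ` ?B = {}"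
    using insert_max_props(3) singleton_max_props(3) by fastforce
  then have "(\<Sum>\<sigma>\<in>OP (Suc n) (Suc k). f (osp_inv \<sigma>))
      = (\<Sum>x\<in>?A. f (osp_inv (insert_max n x))) + (\<Sum>x\<in>?B. f (osp_inv (singleton_max n x)))"
    unfolding OP_Suc_Suc
    by (subst sum.union_disjoint) (simp_all add: sum.reindex inj_insert_max inj_singleton_max)
  also have "(\<Sum>x\<in>?A. f (osp_inv (insert_max n x))) = (\<Sum>(l, \<sigma>)\<in>?A. f (osp_inv \<sigma> + (k - l)))"
    by (intro sum.cong) (auto simp: insert_max_props(2))
  also have "\<dots> = (\<Sum>l\<le>k. \<Sum>\<sigma>\<in>OP n (Suc k). f (osp_inv \<sigma> + (k - l)))"
    by (rule sum.cartesian_product[symmetric])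
  also have "\<dots> = (\<Sum>l\<le>k. \<Sum>\<sigma>\<in>OP n (Suc k). f (osp_inv \<sigma> + l))"
    by (rule rev)
  also have "(\<Sum>x\<in>?B. f (osp_inv (singleton_max n x))) = (\<Sum>(l, \<sigma>)\<in>?B. f (osp_inv \<sigma> + (k - l)))"
    by (intro sum.cong) (auto simp: singleton_max_props(2))
  also have "\<dots> = (\<Sum>l\<le>k. \<Sum>\<sigma>\<in>OP n k. f (osp_inv \<sigma> + (k - l)))"
    by (rule sum.cartesian_product[symmetric])
  also have "\<dots> = (\<Sum>l\<le>k. \<Sum>\<sigma>\<in>OP n k. f (osp_inv \<sigma> + l))"
    by (rule rev)
  finally show ?thesis
    by (simp add: sum.distrib)
qed

lemma OP_gt: "n < k \<Longrightarrow> OP n k = {}"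
proof (induction n arbitrary: k)
  case 0
  then show ?case
    by (cases k) (simp_all add: OP_0_Suc)
next
  case (Suc n)
  then show ?case
    by (cases k) (simp_all add: OP_Suc_Suc)
qed

theorem card_OP: "card (OP n k) = fact k * Stirling n k"
proof (induction n arbitrary: k)
  case 0
  show ?case
    by (cases k) (simp_all add: OP_0_0 OP_0_Suc)
next
  case (Suc n)
  show ?case
  proof (cases k)
    case 0
    then show ?thesis
      by (simp add: OP_Suc_0)
  next
    case (Suc k')
    have "card (OP (Suc n) (Suc k')) = Suc k' * (card (OP n (Suc k')) + card (OP n k'))"
      using sum_OP_Suc_Suc[of "\<lambda>_. 1::nat" n k'] by simp
    then show ?thesis
      using Suc Suc.IH by (simp add: algebra_simps)
  qed
qed

section \<open>Generating functions\<close>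

definition inv_gf :: "nat \<Rightarrow> nat \<Rightarrow> int poly" where
  "inv_gf n k = (\<Sum>\<sigma>\<in>OP n k. Polynomial.monom 1 (osp_inv \<sigma>))"

definition coinv_gf :: "nat \<Rightarrow> nat \<Rightarrow> int poly" where
  "coinv_gf n k = (\<Sum>\<sigma>\<in>OP n k. Polynomial.monom 1 (coinv n k \<sigma>))"

definition stairs_gf :: "nat \<Rightarrow> nat \<Rightarrow> nat \<Rightarrow> int poly" where
  "stairs_gf n k s = (\<Sum>t\<in>stairs n k s. Polynomial.monom 1 (mon_degree t))"

lemma monom_1_mult: "Polynomial.monom (1::int) a * Polynomial.monom 1 b = Polynomial.monom 1 (a + b)"
  by (simp add: mult_monom)

lemma q_int_Suc: "q_int (Suc k) = (\<Sum>l\<le>k. Polynomial.monom 1 l)"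
  by (simp add: q_int_def lessThan_Suc_atMost)

lemma q_int_add: "q_int (a + b) = q_int a + Polynomial.monom 1 a * q_int b"
  by (induction b) (simp_all add: q_int_def algebra_simps monom_1_mult)

lemma inv_gf_Suc_Suc: "inv_gf (Suc n) (Suc k) = q_int (Suc k) * (inv_gf n (Suc k) + inv_gf n k)"
  unfolding inv_gf_def sum_OP_Suc_Suc[of "Polynomial.monom 1"] q_int_Suc sum_distrib_right
  by (intro sum.cong) (simp_all add: distrib_left sum_distrib_left monom_1_mult add.commute)

text \<open>Starts at \<open>Suc n\<close> because at \<open>n = k = 0\<close> the junk value
  \<open>q_stirling 0 0 = 0\<close> disagrees with the one empty partition.\<close>

lemma inv_gf_eq_q_stirling: "inv_gf (Suc n) k = q_fact k * q_stirling (Suc n) k"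
proof (induction n arbitrary: k)
  case 0
  show ?case
  proof (cases k)
    case (Suc k')
    then show ?thesis
      by (cases k') (simp_all add: inv_gf_Suc_Suc, simp_all add: inv_gf_def OP_0_0 OP_0_Suc
          q_fact_def osp_inv_def osp_inversions_def)
  qed (simp add: inv_gf_def OP_Suc_0)
next
  case (Suc n)
  show ?case
  proof (cases k)
    case (Suc k')
    have "q_fact (Suc k') = q_int (Suc k') * q_fact k'"
      by (simp add: q_fact_def mult.commute)
    then show ?thesis
      using Suc Suc.IH inv_gf_Suc_Suc[of "Suc n" k'] by (simp add: algebra_simps)
  qed (simp add: inv_gf_def OP_Suc_0)
qed

text \<open>Let \<open>D n k\<close> be the upper bound on inversions. It grows by \<open>k\<close>
  from \<open>(n, k + 1)\<close> to \<open>(n + 1, k + 1)\<close>, and by \<open>k + (n - k)\<close>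
  from \<open>(n, k)\<close>; with \<open>l\<close> new inversions this leaves \<open>k - l\<close>
  new coinversions, and \<open>n - k\<close> more when a singleton is added.\<close>

lemma coinv_gf_Suc_Suc:
  assumes "k \<le> n"
  shows "coinv_gf (Suc n) (Suc k)
    = q_int (Suc k) * (coinv_gf n (Suc k) + Polynomial.monom 1 (n - k) * coinv_gf n k)"
proof -
  define D where "D = (\<lambda>n k. (n - k) * (k - 1) + (k choose 2))"
  have "coinv_gf (Suc n) (Suc k) = (\<Sum>\<sigma>\<in>OP (Suc n) (Suc k). Polynomial.monom 1 (D (Suc n) (Suc k) - osp_inv \<sigma>))"
    by (simp add: coinv_gf_def coinv_def D_def)
  also have "\<dots> = (\<Sum>l\<le>k. (\<Sum>\<sigma>\<in>OP n (Suc k). Polynomial.monom 1 (D (Suc n) (Suc k) - (osp_inv \<sigma> + l)))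
      + (\<Sum>\<sigma>\<in>OP n k. Polynomial.monom 1 (D (Suc n) (Suc k) - (osp_inv \<sigma> + l))))"
    by (rule sum_OP_Suc_Suc)
  also have "\<dots> = (\<Sum>l\<le>k. Polynomial.monom 1 (k - l) *
      (coinv_gf n (Suc k) + Polynomial.monom 1 (n - k) * coinv_gf n k))"
  proof (intro sum.cong refl)
    fix l assume l: "l \<in> {..k}"
    have "D (Suc n) (Suc k) - (osp_inv \<sigma> + l) = (k - l) + coinv n (Suc k) \<sigma>" if "\<sigma> \<in> OP n (Suc k)" for \<sigma>
    proof -
      have "Suc k \<le> n"
        using that OP_gt[of n "Suc k"] by (cases "n < Suc k") auto
      then obtain d where "n = Suc k + d"
        by (metis le_Suc_ex)
      then have "D (Suc n) (Suc k) = k + D n (Suc k)"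
        by (simp add: D_def)
      moreover have "osp_inv \<sigma> \<le> D n (Suc k)"
        using osp_inv_le[OF that] by (simp add: D_def)
      ultimately show ?thesis
        using l by (simp add: coinv_def D_def)
    qed
    moreover have "D (Suc n) (Suc k) - (osp_inv \<sigma> + l) = (k - l) + ((n - k) + coinv n k \<sigma>)"
      if "\<sigma> \<in> OP n k" for \<sigma>
    proof -
      have "D (Suc n) (Suc k) = k + (n - k) + D n k"
      \<comment> \<open>At \<open>k = 0\<close> the subtraction \<open>k - 1\<close> truncates, and
        the identity is saved by \<open>n = 0\<close>: no other \<open>OP n 0\<close> has an
        element.\<close>
      proof (cases k)
        case 0
        then have "n = 0"
          using that OP_Suc_0 by (cases n) auto
        then show ?thesis
          using 0 by (simp add: D_def numeral_2_eq_2)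
      next
        case (Suc k')
        obtain d where "n = k + d"
          using assms by (metis le_Suc_ex)
        then show ?thesis
          using Suc by (simp add: D_def numeral_2_eq_2 algebra_simps)
      qed
      moreover have "osp_inv \<sigma> \<le> D n k" "coinv n k \<sigma> = D n k - osp_inv \<sigma>"
        using osp_inv_le[OF that] by (simp_all add: D_def coinv_def)
      ultimately show ?thesis
        using l by simp
    qed
    ultimately show "(\<Sum>\<sigma>\<in>OP n (Suc k). Polynomial.monom 1 (D (Suc n) (Suc k) - (osp_inv \<sigma> + l)))
      + (\<Sum>\<sigma>\<in>OP n k. Polynomial.monom 1 (D (Suc n) (Suc k) - (osp_inv \<sigma> + l)))
      = Polynomial.monom (1::int) (k - l) * (coinv_gf n (Suc k) + Polynomial.monom 1 (n - k) * coinv_gf n k)"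
      by (simp add: coinv_gf_def distrib_left sum_distrib_left monom_1_mult)
  qed
  also have "\<dots> = (\<Sum>l\<le>k. Polynomial.monom 1 (k - l)) *
      (coinv_gf n (Suc k) + Polynomial.monom 1 (n - k) * coinv_gf n k)"
    by (simp add: sum_distrib_right)
  also have "(\<Sum>l\<le>k. Polynomial.monom 1 (k - l)) = q_int (Suc k)"
    unfolding q_int_Suc by (rule sum.reindex_bij_witness[of _ "\<lambda>l. k - l" "\<lambda>l. k - l"]) auto
  finally show ?thesis .
qed

lemma coinv_gf_gt: "n < k \<Longrightarrow> coinv_gf n k = 0"
  by (simp add: coinv_gf_def OP_gt)

section \<open>The generating function of the staircase monomials\<close>

lemma stairs_gf_Suc:
  assumes "s \<le> k"
  shows "stairs_gf (Suc n) k s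
    = q_int s * stairs_gf n k (s - 1) + Polynomial.monom 1 s * q_int (k - s) * stairs_gf n k s"
proof -
  let ?s = "\<lambda>i. if i < s then s - 1 else s"
  have notin: "Poly_Mapping.lookup t (Suc n) = 0" if "t \<in> stairs n k r" for t r
  proof -
    have "Suc n \<notin> Poly_Mapping.keys t"
      using that stairs_expos by (force simp: expos_def)
    then show ?thesis
      by (simp add: in_keys_iff)
  qed
  have inj: "inj_on (\<lambda>(i, t). Poly_Mapping.single (Suc n) i + t) (SIGMA i:{..<k}. stairs n k (?s i))"
  proof (rule inj_onI)
    fix x x'
    assume "x \<in> (SIGMA i:{..<k}. stairs n k (?s i))" "x' \<in> (SIGMA i:{..<k}. stairs n k (?s i))"
      and "(\<lambda>(i, t). Poly_Mapping.single (Suc n) i + t) x = (\<lambda>(i, t). Poly_Mapping.single (Suc n) i + t) x'"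
    moreover obtain i t j u where x: "x = (i, t)" "x' = (j, u)"
      by (metis surj_pair)
    ultimately have t: "t \<in> stairs n k (?s i)" and u: "u \<in> stairs n k (?s j)"
      and eq: "Poly_Mapping.single (Suc n) i + t = Poly_Mapping.single (Suc n) j + u"
      by auto
    have "i = Poly_Mapping.lookup (Poly_Mapping.single (Suc n) i + t) (Suc n)"
      using notin[OF t] by (simp add: lookup_add)
    moreover have "j = Poly_Mapping.lookup (Poly_Mapping.single (Suc n) j + u) (Suc n)"
      using notin[OF u] by (simp add: lookup_add)
    ultimately have "i = j"
      using eq by simp
    then show "x = x'"
      unfolding x
      using eq by simp
  qed
  have "stairs_gf (Suc n) k s
      = (\<Sum>(i, t)\<in>(SIGMA i:{..<k}. stairs n k (?s i)). Polynomial.monom 1 (i + mon_degree t))"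
    by (simp only: stairs_gf_def stairs.simps sum.reindex[OF inj])
       (intro sum.cong, auto)
  also have "\<dots> = (\<Sum>i<k. Polynomial.monom 1 i * stairs_gf n k (?s i))"
    by (subst sum.Sigma[symmetric]) (simp_all add: stairs_gf_def sum_distrib_left monom_1_mult)
  also have "{..<k} = {..<s} \<union> {s..<k}"
    using assms by auto
  also have "(\<Sum>i\<in>{..<s} \<union> {s..<k}. Polynomial.monom 1 i * stairs_gf n k (?s i))
      = (\<Sum>i<s. Polynomial.monom 1 i) * stairs_gf n k (s - 1)
        + (\<Sum>i\<in>{s..<k}. Polynomial.monom 1 i) * stairs_gf n k s"
    by (subst sum.union_disjoint) (auto simp: sum_distrib_right)
  also have "(\<Sum>i\<in>{s..<k}. Polynomial.monom 1 i) = Polynomial.monom 1 s * q_int (k - s)"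
    unfolding q_int_def sum_distrib_left monom_1_mult
    by (rule sum.reindex_bij_witness[of _ "\<lambda>i. s + i" "\<lambda>i. i - s"]) auto
  finally show ?thesis
    by (simp add: q_int_def)
qed

lemma stairs_gf_0: "stairs_gf 0 k s = (if s = 0 then 1 else 0)"
  by (simp add: stairs_gf_def)

lemma stairs_gf_gt: "s \<le> k \<Longrightarrow> n < s \<Longrightarrow> stairs_gf n k s = 0"
  by (induction n arbitrary: s) (simp_all add: stairs_gf_0 stairs_gf_Suc)

text \<open>At \<open>q = 1\<close> this counts maps from \<open>n\<close> points to \<open>{1..Suc k}\<close> with image containing \<open>{1..s}\<close>
  by whether \<open>Suc k\<close> is in the image.\<close>

lemma stairs_gf_split:
  assumes "s \<le> k" "s \<le> n"
  shows "stairs_gf n (Suc k) s = stairs_gf n (Suc k) (Suc s) + Polynomial.monom 1 (n - s) * stairs_gf n k s"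
  using assms
proof (induction n arbitrary: s)
  case 0
  then show ?case
    by (simp add: stairs_gf_0)
next
  case (Suc n)
  \<comment> \<open>The recursion for \<open>stairs_gf (Suc n) k s\<close> has a term at
    \<open>s - 1\<close> and a term at \<open>s\<close>. Multiplied by \<open>q^(n + 1 - s)\<close>,
    each becomes an instance of the induction hypothesis; the factor \<open>q_int s\<close> disposes
    of \<open>s = 0\<close>.\<close>
  have IH1: "q_int s * (Polynomial.monom 1 (Suc n - s) * stairs_gf n k (s - 1))
      = q_int s * (stairs_gf n (Suc k) (s - 1) - stairs_gf n (Suc k) s)"
  proof (cases s)
    case (Suc s')
    then show ?thesis
      using Suc.IH[of s'] Suc.prems by simp
  qed (simp add: q_int_def)
  have IH2: "Polynomial.monom 1 (Suc n - s) * stairs_gf n k s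
      = Polynomial.monom 1 1 * (stairs_gf n (Suc k) s - stairs_gf n (Suc k) (Suc s))"
  proof (cases "s \<le> n")
    case True
    have "Polynomial.monom 1 (Suc n - s) = Polynomial.monom (1::int) 1 * Polynomial.monom 1 (n - s)"
      using True by (simp add: monom_1_mult Suc_diff_le)
    then show ?thesis
      using Suc.IH[OF Suc.prems(1) True] by (simp add: mult.assoc)
  next
    \<comment> \<open>Now \<open>s = n + 1\<close>, beyond the reach of the induction hypothesis,
      but all three generating functions are 0.\<close>
    case False
    then show ?thesis
      using Suc.prems by (simp add: stairs_gf_gt)
  qed
  let ?q = "Polynomial.monom (1::int)"
  have q1: "q_int (Suc s) = q_int s + ?q s"
    by (simp add: q_int_def)
  have q2: "q_int (Suc k - s) = 1 + ?q 1 * q_int (k - s)"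
    using q_int_add[of 1 "k - s"] Suc.prems by (simp add: q_int_def Suc_diff_le)
  have q3: "?q (Suc s) = ?q s * ?q 1"
    by (simp add: monom_1_mult)
  have "?q (Suc n - s) * stairs_gf (Suc n) k s
      = q_int s * (?q (Suc n - s) * stairs_gf n k (s - 1))
        + ?q s * q_int (k - s) * (?q (Suc n - s) * stairs_gf n k s)"
    using Suc.prems by (simp add: stairs_gf_Suc algebra_simps)
  also have "\<dots> = q_int s * (stairs_gf n (Suc k) (s - 1) - stairs_gf n (Suc k) s)
      + ?q s * q_int (k - s) * (?q 1 * (stairs_gf n (Suc k) s - stairs_gf n (Suc k) (Suc s)))"
    unfolding IH1 IH2 ..
  finally have eq: "?q (Suc n - s) * stairs_gf (Suc n) k s = \<dots>" .
  have "stairs_gf (Suc n) (Suc k) s = q_int s * stairs_gf n (Suc k) (s - 1)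
      + ?q s * (1 + ?q 1 * q_int (k - s)) * stairs_gf n (Suc k) s"
    using Suc.prems by (simp add: stairs_gf_Suc q2)
  moreover have "stairs_gf (Suc n) (Suc k) (Suc s) = (q_int s + ?q s) * stairs_gf n (Suc k) s
      + ?q s * ?q 1 * q_int (k - s) * stairs_gf n (Suc k) (Suc s)"
    using Suc.prems by (simp add: stairs_gf_Suc q1 q3)
  ultimately show ?case
    unfolding eq by (simp only: algebra_simps)
qed

text \<open>For \<open>s = k = j + 1\<close> the recursion leaves only the term with
  \<open>stairs_gf n (j + 1) j\<close>; splitting it by \<open>stairs_gf_split\<close> produces the
  recursion \<open>coinv_gf_Suc_Suc\<close>.\<close>

theorem stairs_gf_eq_coinv_gf: "stairs_gf n k k = coinv_gf n k"
proof (induction n arbitrary: k)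
  case 0
  show ?case
    by (cases k) (simp_all add: stairs_gf_0 coinv_gf_gt, simp add: coinv_gf_def OP_0_0 coinv_def numeral_2_eq_2)
next
  case (Suc n)
  show ?case
  proof (cases k)
    case 0
    then show ?thesis
      by (simp add: stairs_gf_Suc coinv_gf_def OP_Suc_0 q_int_def)
  next
    case (Suc j)
    show ?thesis
    proof (cases "j \<le> n")
      case True
      then show ?thesis
        using stairs_gf_split[of j j n] Suc.IH
        by (simp add: Suc stairs_gf_Suc coinv_gf_Suc_Suc q_int_def)
    next
      case False
      then show ?thesis
        using Suc by (simp add: stairs_gf_gt coinv_gf_gt)
    qed
  qed
qed

text \<open>For \<open>k = j + 1\<close> exactly one of the two summands of the recursion has a
  nonzero constant term: the first if \<open>j < n\<close>, the second if
  \<open>j = n\<close>.\<close>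

lemma coeff_0_coinv_gf:
  assumes "1 \<le> k" "k \<le> n"
  shows "poly.coeff (coinv_gf n k) 0 = 1"
  using assms
proof (induction n arbitrary: k)
  case (Suc n)
  then obtain j where k: "k = Suc j" "j \<le> n"
    by (cases k) auto
  have q0: "poly.coeff (q_int (Suc i)) 0 = 1" for i
    by (simp add: q_int_def coeff_sum)
  have "poly.coeff (coinv_gf n (Suc j)) 0 = (if j < n then 1 else 0)"
    using Suc.IH[of "Suc j"] by (auto simp: coinv_gf_gt)
  moreover have "poly.coeff (coinv_gf n n) 0 = 1"
  proof (cases n)
    case 0
    then show ?thesis
      by (simp add: coinv_gf_def OP_0_0 coinv_def osp_inv_def osp_inversions_def)
  next
    case (Suc n')
    then show ?thesis
      using Suc.IH[of n] by simp
  qed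
  ultimately show ?case
    using k by (auto simp: coinv_gf_Suc_Suc coeff_mult_0 q0)
qed simp

text \<open>\<open>reflect_poly\<close> reverses around the actual degree, \<open>coinv\<close>
  around the bound \<open>D\<close>; the constant term of \<open>coinv_gf\<close> shows that the two
  coincide.\<close>

theorem coinv_gf_eq_reflect_poly:
  assumes "1 \<le> k" "k \<le> n"
  shows "coinv_gf n k = reflect_poly (inv_gf n k)"
proof -
  define D where "D = (n - k) * (k - 1) + (k choose 2)"
  have le: "osp_inv \<sigma> \<le> D" if "\<sigma> \<in> OP n k" for \<sigma>
    using osp_inv_le[OF that] by (simp add: D_def)
  have coeff_inv: "poly.coeff (inv_gf n k) i = (\<Sum>\<sigma>\<in>OP n k. if osp_inv \<sigma> = i then 1 else 0)" for i
    by (simp add: inv_gf_def coeff_sum)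
  have coeff_coinv: "poly.coeff (coinv_gf n k) i = (\<Sum>\<sigma>\<in>OP n k. if D - osp_inv \<sigma> = i then 1 else 0)" for i
    by (simp add: coinv_gf_def coeff_sum coinv_def D_def)
  have "poly.coeff (inv_gf n k) D = poly.coeff (coinv_gf n k) 0"
    unfolding coeff_inv coeff_coinv using le by (intro sum.cong) force+
  then have "poly.coeff (inv_gf n k) D \<noteq> 0"
    using coeff_0_coinv_gf[OF assms] by simp
  moreover have "poly.coeff (inv_gf n k) i = 0" if "D < i" for i
    unfolding coeff_inv using le that by (intro sum.neutral) force
  ultimately have deg: "degree (inv_gf n k) = D"
    by (intro antisym degree_le le_degree) auto
  show ?thesis
  proof (rule poly_eqI)
    fix i
    show "poly.coeff (coinv_gf n k) i = poly.coeff (reflect_poly (inv_gf n k)) i"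
      unfolding coeff_reflect_poly deg coeff_coinv coeff_inv using le
      by (auto intro!: sum.cong sum.neutral)
  qed
qed

section \<open>Linear independence modulo the ideal\<close>

lemma OP_nth_disjoint:
  assumes "\<sigma> \<in> OP n k" "l < k" "m < k" "i \<in> \<sigma> ! l" "i \<in> \<sigma> ! m"
  shows "l = m"
proof -
  have \<sigma>: "length \<sigma> = k" "distinct \<sigma>" "disjoint (set \<sigma>)"
    using assms(1) by (auto simp: OP_def partition_on_def)
  then have "\<sigma> ! l \<in> set \<sigma>" "\<sigma> ! m \<in> set \<sigma>"
    using assms by auto
  then have "\<sigma> ! l = \<sigma> ! m"
    using \<sigma>(3) assms(4,5) unfolding disjoint_def by blast
  then show ?thesis
    using \<sigma> assms(2,3) by (simp add: nth_eq_iff_index_eq)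
qed

text \<open>Blocks are numbered from 0, so the coordinates are the roots
  \<open>0, ..., k - 1\<close> of the products used for the generators. Indices outside
  \<open>{1..n}\<close> get an arbitrary value, hence points are compared on \<open>{1..n}\<close>
  only.\<close>

definition osp_point :: "nat set list \<Rightarrow> nat \<Rightarrow> rat" where
  "osp_point \<sigma> i = of_nat (THE m. m < length \<sigma> \<and> i \<in> \<sigma> ! m)"

lemma osp_point_eq:
  assumes "\<sigma> \<in> OP n k" "m < k" "i \<in> \<sigma> ! m"
  shows "osp_point \<sigma> i = of_nat m"
proof -
  have "(THE m. m < length \<sigma> \<and> i \<in> \<sigma> ! m) = m"
    using assms OP_nth_disjoint[OF assms(1)] by (intro the_equality) (auto simp: OP_def)
  then show ?thesis
    by (simp add: osp_point_def)
qed

lemma OP_mem_block: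
  assumes "\<sigma> \<in> OP n k" "i \<in> {1..n}"
  obtains m where "m < k" "i \<in> \<sigma> ! m"
proof -
  have "i \<in> \<Union> (set \<sigma>)" "length \<sigma> = k"
    using assms by (auto simp: OP_def partition_on_def)
  then show thesis
    using that by (auto simp: in_set_conv_nth)
qed

lemma OP_nth_eq:
  assumes "\<sigma> \<in> OP n k" "m < k"
  shows "\<sigma> ! m = {i \<in> {1..n}. osp_point \<sigma> i = of_nat m}"
proof -
  have "\<sigma> ! m \<in> set \<sigma>"
    using assms by (auto simp: OP_def)
  then have "\<sigma> ! m \<subseteq> {1..n}"
    using OP_blocks(3)[OF assms(1)] by blast
  moreover have "i \<in> \<sigma> ! m" if i: "i \<in> {1..n}" "osp_point \<sigma> i = of_nat m" for i
  proof -
    obtain l where "l < k" "i \<in> \<sigma> ! l"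
      using OP_mem_block[OF assms(1) i(1)] .
    then show ?thesis
      using osp_point_eq[OF assms(1)] i(2) by (metis of_nat_eq_iff)
  qed
  ultimately show ?thesis
    using osp_point_eq[OF assms] by blast
qed

lemma osp_point_separates:
  assumes "\<sigma> \<in> OP n k" "\<tau> \<in> OP n k" "\<sigma> \<noteq> \<tau>"
  shows "\<exists>i\<in>{1..n}. osp_point \<sigma> i \<noteq> osp_point \<tau> i"
proof (rule ccontr)
  assume "\<not> ?thesis"
  then have "\<sigma> ! m = \<tau> ! m" if "m < k" for m
    using that assms by (auto simp: OP_nth_eq)
  moreover have "length \<sigma> = k" "length \<tau> = k"
    using assms by (auto simp: OP_def)
  ultimately show False
    using assms(3) by (metis nth_equalityI)
qed

lemma surj_point_osp_point:
  assumes "\<sigma> \<in> OP n k"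
  shows "surj_point n k (osp_point \<sigma>)"
  unfolding surj_point_def
proof (intro equalityI subsetI)
  fix x assume "x \<in> osp_point \<sigma> ` {1..n}"
  then obtain i where i: "i \<in> {1..n}" "x = osp_point \<sigma> i"
    by auto
  obtain m where "m < k" "i \<in> \<sigma> ! m"
    using OP_mem_block[OF assms i(1)] .
  then show "x \<in> of_nat ` {..<k}"
    using osp_point_eq[OF assms] i(2) by auto
next
  fix x assume "x \<in> (of_nat ` {..<k} :: rat set)"
  then obtain m where m: "m < k" "x = of_nat m"
    by auto
  then have "\<sigma> ! m \<in> set \<sigma>"
    using assms by (auto simp: OP_def)
  then obtain i where i: "i \<in> \<sigma> ! m" "i \<in> {1..n}"
    using OP_blocks(2,3)[OF assms] by blast
  then show "x \<in> osp_point \<sigma> ` {1..n}"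
    using osp_point_eq[OF assms m(1) i(1)] m(2) by (intro image_eqI[OF _ i(2)]) simp
qed

lemma card_OP_le_graded_spanning:
  assumes "finite B"
    and "\<And>t. t \<in> expos n \<Longrightarrow> mmon t \<in> mp.span (igens n k k (mon_degree t) \<union> mmon ` B)"
  shows "card (OP n k) \<le> card B"
proof -
  have "inj_on osp_point (OP n k)"
    using osp_point_separates by (intro inj_onI) metis
  then have "card (OP n k) = card (osp_point ` OP n k)"
    by (simp add: card_image)
  also have "\<dots> \<le> card B"
  proof (rule card_points_le)
    show "mmon t \<in> mp.span (mmon ` B \<union> vanishing (osp_point ` OP n k))" if "t \<in> expos n" for t
      using that assms(2) surj_point_osp_point
      by (intro graded_spanning_imp_spanning_on_points) auto
    fix y z assume "y \<in> osp_point ` OP n k" "z \<in> osp_point ` OP n k" "y \<noteq> z"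
    then obtain \<sigma> \<tau> where "\<sigma> \<in> OP n k" "\<tau> \<in> OP n k" "\<sigma> \<noteq> \<tau>" "y = osp_point \<sigma>" "z = osp_point \<tau>"
      by blast
    then show "\<exists>i\<in>{1..n}. y i \<noteq> z i"
      using osp_point_separates by simp
  qed (use assms(1) in simp_all)
  finally show ?thesis .
qed

lemma card_stairs: "card (stairs n k k) = card (OP n k)"
proof -
  have "int (card (stairs n k k)) = poly (stairs_gf n k k) 1"
    by (simp add: stairs_gf_def poly_sum poly_monom)
  also have "\<dots> = int (card (OP n k))"
    by (simp add: stairs_gf_eq_coinv_gf coinv_gf_def poly_sum poly_monom)
  finally show ?thesis
    by simp
qed

section \<open>Homogeneous components and the ideal as a graded subspace\<close>

definition hcomp :: "nat \<Rightarrow> mpoly \<Rightarrow> mpoly" where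
  "hcomp d = Poly_Mapping.mapp (\<lambda>t c. if mon_degree t = d then c else 0)"

lemma lookup_hcomp:
  "Poly_Mapping.lookup (hcomp d p) t = (if mon_degree t = d then Poly_Mapping.lookup p t else 0)"
  by (auto simp: hcomp_def lookup_mapp when_def in_keys_iff)

lemma hcomp_add: "hcomp d (p + q) = hcomp d p + hcomp d q"
  and hcomp_scale: "hcomp d (mconst c * p) = mconst c * hcomp d p"
  and hcomp_diff: "hcomp d (p - q) = hcomp d p - hcomp d q"
  and hcomp_0: "hcomp d 0 = 0"
  by (rule poly_mapping_eqI, simp add: lookup_hcomp lookup_add lookup_minus)+

lemma hcomp_span:
  assumes "\<And>p. p \<in> S \<Longrightarrow> hcomp d p \<in> mp.span T" "p \<in> mp.span S"
  shows "hcomp d p \<in> mp.span T"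
  using assms(2)
  by (induction rule: mp.span_induct_alt)
     (auto simp: hcomp_0 hcomp_add hcomp_scale mp.span_zero intro!: mp.span_add mp.span_scale assms(1))

lemma hcomp_homogeneous: "homogeneous e p \<Longrightarrow> hcomp d p = (if d = e then p else 0)"
  by (rule poly_mapping_eqI) (auto simp: lookup_hcomp homogeneous_def in_keys_iff)

lemma homogeneous_iff_span:
  "p \<in> mpolys n \<and> homogeneous d p \<longleftrightarrow> p \<in> mp.span (mmon ` {t \<in> expos n. mon_degree t = d})"
proof -
  have "p \<in> mpolys n \<and> homogeneous d p \<longleftrightarrow> Poly_Mapping.keys p \<subseteq> {t \<in> expos n. mon_degree t = d}"
    by (auto simp: mpolys_def homogeneous_def expos_def)
  then show ?thesis
    using mem_span_mmon keys_span_mmon by blast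
qed

lemma gens_span:
  assumes "(e, g) \<in> gens n k s"
  shows "g \<in> mp.span (mmon ` {t \<in> expos n. mon_degree t = e})"
proof -
  from assms consider i where "i \<in> {1..n}" "e = k" "g = mvar i ^ k" | "g = elem_sym n e"
    by (auto simp: gens_def)
  then show ?thesis
  proof cases
    case 1
    then show ?thesis
      using expos_single by (auto simp: mvar_power intro!: mp.span_base imageI)
  qed (simp add: elem_sym_span)
qed

lemma igens_span:
  assumes "p \<in> igens n k s d"
  shows "p \<in> mp.span (mmon ` {t \<in> expos n. mon_degree t = d})"
proof -
  obtain u e g where p: "p = mmon u * g" "u \<in> expos n" "(e, g) \<in> gens n k s" "mon_degree u + e = d"
    using assms unfolding igens_def by auto
  have "mmon u * g \<in> mp.span (mmon ` {t \<in> expos n. mon_degree t = d})"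
  proof (rule span_mult_closed[OF _ gens_span[OF p(3)]])
    fix q assume "q \<in> mmon ` {t \<in> expos n. mon_degree t = e}"
    then show "mmon u * q \<in> mp.span (mmon ` {t \<in> expos n. mon_degree t = d})"
      using p(2,4) by (auto simp: mmon_mult intro!: mp.span_base imageI expos_add)
  qed
  then show ?thesis
    using p(1) by simp
qed

text \<open>The ideal as a rational subspace, spanned by homogeneous elements so that it is visibly
  closed under homogeneous components; see \<open>ideal_I_eq_ispan\<close>.\<close>

definition ispan :: "nat \<Rightarrow> nat \<Rightarrow> mpoly set" where
  "ispan n k = mp.span (\<Union>d. igens n k k d)"

lemma hcomp_ispan:
  assumes "p \<in> ispan n k"
  shows "hcomp d p \<in> mp.span (igens n k k d)"
proof (rule hcomp_span[OF _ assms[unfolded ispan_def]])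
  fix q assume "q \<in> (\<Union>e. igens n k k e)"
  then obtain e where "q \<in> igens n k k e" "homogeneous e q"
    using igens_span homogeneous_iff_span by blast
  then show "hcomp d q \<in> mp.span (igens n k k d)"
    by (auto simp: hcomp_homogeneous mp.span_zero intro: mp.span_base)
qed

text \<open>Otherwise \<open>t\<close> could be dropped from the spanning set of staircase monomials, leaving fewer
  monomials than there are points.\<close>

lemma stairs_independent:
  assumes "t \<in> stairs n k k" "q \<in> mp.span (mmon ` (stairs n k k - {t}))"
  shows "mmon t - q \<notin> ispan n k"
proof
  assume I: "mmon t - q \<in> ispan n k"
  let ?d = "mon_degree t" and ?B = "stairs n k k - {t}"
  have hom: "hcomp d (mmon u) = (if mon_degree u = d then mmon u else 0)" for d u
    by (subst hcomp_homogeneous[of "mon_degree u"]) (auto simp: homogeneous_def mmon_def)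
  \<comment> \<open>A relation may mix degrees; its component in the degree of \<open>t\<close> is
    what the degreewise spanning condition can use.\<close>
  have "hcomp ?d q \<in> mp.span (mmon ` ?B)"
  proof (rule hcomp_span[OF _ assms(2)])
    fix p assume "p \<in> mmon ` ?B"
    then obtain u where u: "p = mmon u" "u \<in> ?B"
      by auto
    then have "mmon u \<in> mp.span (mmon ` ?B)"
      by (intro mp.span_base imageI)
    then show "hcomp ?d p \<in> mp.span (mmon ` ?B)"
      unfolding u(1) hom using mp.span_zero by (cases "mon_degree u = ?d") (simp_all only: if_True if_False refl)
  qed
  then have "hcomp ?d q \<in> mp.span (igens n k k ?d \<union> mmon ` ?B)"
    using mp.span_mono[of "mmon ` ?B" "igens n k k ?d \<union> mmon ` ?B"] by blast
  moreover have "mmon t - hcomp ?d q \<in> mp.span (igens n k k ?d \<union> mmon ` ?B)"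
    using hcomp_ispan[OF I, of ?d] mp.span_mono[of "igens n k k ?d" "igens n k k ?d \<union> mmon ` ?B"]
    by (auto simp: hcomp_diff hom)
  ultimately have "(mmon t - hcomp ?d q) + hcomp ?d q \<in> mp.span (igens n k k ?d \<union> mmon ` ?B)"
    by (intro mp.span_add)
  then have t: "mmon t \<in> mp.span (igens n k k ?d \<union> mmon ` ?B)"
    by simp
  have "mmon u \<in> mp.span (igens n k k (mon_degree u) \<union> mmon ` ?B)" if "u \<in> expos n" for u
  proof -
    let ?S = "mp.span (igens n k k (mon_degree u) \<union> mmon ` ?B)"
    have "mmon ` {v \<in> stairs n k k. mon_degree v = mon_degree u} \<subseteq> ?S"
    proof (rule image_subsetI)
      fix v assume "v \<in> {v \<in> stairs n k k. mon_degree v = mon_degree u}"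
      then show "mmon v \<in> ?S"
        using t by (cases "v = t") (auto intro: mp.span_base)
    qed
    then have "hspan n k k (mon_degree u) \<subseteq> ?S"
      unfolding hspan_def by (intro mp.span_minimal) (auto intro: mp.span_base)
    then show ?thesis
      using mmon_mem_hspan[OF that] by blast
  qed
  then have "card (OP n k) \<le> card ?B"
    by (intro card_OP_le_graded_spanning) auto
  also have "\<dots> < card (stairs n k k)"
    using assms(1) by (intro psubset_card_mono) auto
  finally show False
    by (simp add: card_stairs)
qed

section \<open>The quotient ring\<close>

lemma mpoly_ring_simps [simp]:
  "carrier (mpoly_ring n) = mpolys n" "x \<otimes>\<^bsub>mpoly_ring n\<^esub> y = x * y"
  "x \<oplus>\<^bsub>mpoly_ring n\<^esub> y = x + y" "\<one>\<^bsub>mpoly_ring n\<^esub> = 1" "\<zero>\<^bsub>mpoly_ring n\<^esub> = 0"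
  by (simp_all add: mpoly_ring_def)

lemma ring_mpoly_ring: "ring (mpoly_ring n)"
  using mpoly_ring_cring cring.axioms(1) by blast

lemma a_inv_mpoly_ring:
  assumes "x \<in> mpolys n"
  shows "\<ominus>\<^bsub>mpoly_ring n\<^esub> x = - x"
proof -
  interpret ring "mpoly_ring n"
    by (rule ring_mpoly_ring)
  show ?thesis
    using minus_equality[of "- x" x] assms by (simp add: mpolys_uminus)
qed

lemma mem_mpolys_span: "p \<in> mpolys n \<Longrightarrow> p \<in> mp.span (mmon ` expos n)"
  by (simp add: mpolys_eq_span)

lemma span_subset_mpolys: "S \<subseteq> mpolys n \<Longrightarrow> mp.span S \<subseteq> mpolys n"
  unfolding mpolys_eq_span by (rule mp.span_minimal) simp_all

lemma mmon_mem_mpolys: "t \<in> expos n \<Longrightarrow> mmon t \<in> mpolys n"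
  by (simp add: mpolys_eq_span mp.span_base)

lemma ispan_subset_mpolys: "ispan n k \<subseteq> mpolys n"
  unfolding ispan_def using igens_span homogeneous_iff_span by (intro span_subset_mpolys) blast

lemma ispan_mult_closed:
  assumes "p \<in> mpolys n" "q \<in> ispan n k"
  shows "p * q \<in> ispan n k"
proof -
  have mmon: "mmon t * q \<in> ispan n k" if "t \<in> expos n" "q \<in> ispan n k" for t q
    unfolding ispan_def
  proof (rule span_mult_closed[OF _ that(2)[unfolded ispan_def]])
    fix r assume "r \<in> (\<Union>d. igens n k k d)"
    then obtain u e g where r: "r = mmon u * g" "u \<in> expos n" "(e, g) \<in> gens n k k"
      unfolding igens_def by auto
    then have "mmon t * r = mmon (t + u) * g"
      by (simp add: mult.assoc flip: mmon_mult)
    then have "mmon t * r \<in> igens n k k (mon_degree (t + u) + e)"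
      using igensI[OF expos_add[OF that(1) r(2)] r(3) refl] by simp
    then show "mmon t * r \<in> mp.span (\<Union>d. igens n k k d)"
      by (auto intro: mp.span_base)
  qed
  have "q * p \<in> mp.span (\<Union>d. igens n k k d)"
  proof (rule span_mult_closed[OF _ mem_mpolys_span[OF assms(1)]])
    fix x assume "x \<in> mmon ` expos n"
    then show "q * x \<in> mp.span (\<Union>d. igens n k k d)"
      using mmon[OF _ assms(2)] unfolding ispan_def mult.commute[of q x] by auto
  qed
  then show ?thesis
    by (simp add: ispan_def mult.commute)
qed

lemma ideal_ispan: "ideal (ispan n k) (mpoly_ring n)"
proof (rule idealI[OF ring_mpoly_ring])
  interpret ring "mpoly_ring n"
    by (rule ring_mpoly_ring)
  show "subgroup (ispan n k) (add_monoid (mpoly_ring n))"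
  proof (rule add.subgroupI)
    show "ispan n k \<noteq> {}"
      using mp.span_zero unfolding ispan_def by blast
    fix a assume a: "a \<in> ispan n k"
    then have "\<ominus>\<^bsub>mpoly_ring n\<^esub> a = - a"
      using ispan_subset_mpolys a_inv_mpoly_ring by blast
    then show "\<ominus>\<^bsub>mpoly_ring n\<^esub> a \<in> ispan n k"
      using a mp.span_neg unfolding ispan_def by metis
  qed (use ispan_subset_mpolys mp.span_add in \<open>auto simp: ispan_def\<close>)
  fix a x assume "a \<in> ispan n k" "x \<in> carrier (mpoly_ring n)"
  then show "x \<otimes>\<^bsub>mpoly_ring n\<^esub> a \<in> ispan n k" "a \<otimes>\<^bsub>mpoly_ring n\<^esub> x \<in> ispan n k"
    using ispan_mult_closed[of x n a k] by (simp_all add: mult.commute)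
qed

text \<open>The generators in \<open>gens n k k\<close> beyond those of \<open>ideal_I\<close> are
  the \<open>e_r\<close> with \<open>r > n\<close>, which are 0. This uses \<open>k \<le> n\<close>:
  for larger \<open>k\<close> the set \<open>gens n k k\<close> would contain
  \<open>e_0 = 1\<close>.\<close>

lemma ideal_I_eq_ispan:
  assumes "k \<le> n"
  shows "ideal_I n k = ispan n k"
proof -
  interpret ring "mpoly_ring n"
    by (rule ring_mpoly_ring)
  let ?G = "(\<lambda>i. mvar i ^ k) ` {1..n} \<union> elem_sym n ` {n - k + 1..n}"
  have gens: "\<exists>e. (e, g) \<in> gens n k k" if "g \<in> ?G" for g
  proof -
    from that consider i where "i \<in> {1..n}" "g = mvar i ^ k" | r where "r \<in> {n - k + 1..n}" "g = elem_sym n r"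
      by blast
    then show ?thesis
    proof cases
      case 1
      then show ?thesis
        unfolding gens_def by blast
    next
      case 2
      then have "(r, g) \<in> gens n k k"
        by (auto simp: gens_def)
      then show ?thesis ..
    qed
  qed
  have G: "?G \<subseteq> ispan n k"
  proof
    fix g assume "g \<in> ?G"
    then obtain e where "(e, g) \<in> gens n k k"
      using gens by blast
    then have "mmon 0 * g \<in> igens n k k e"
      by (intro igensI) auto
    then show "g \<in> ispan n k"
      unfolding ispan_def by (auto intro: mp.span_base)
  qed
  then have carr: "?G \<subseteq> carrier (mpoly_ring n)"
    using ispan_subset_mpolys[of n k] by (simp only: mpoly_ring_simps)
  interpret I: ideal "ideal_I n k" "mpoly_ring n"
    unfolding ideal_I_def by (rule genideal_ideal[OF carr])
  have GI: "?G \<subseteq> ideal_I n k"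
    unfolding ideal_I_def by (rule genideal_self[OF carr])
  show ?thesis
  proof
    show "ideal_I n k \<subseteq> ispan n k"
      unfolding ideal_I_def by (rule genideal_minimal[OF ideal_ispan G])
    have "igens n k k d \<subseteq> ideal_I n k" for d
    proof
      fix p assume "p \<in> igens n k k d"
      then obtain u e g where p: "p = mmon u * g" "u \<in> expos n" "(e, g) \<in> gens n k k"
        unfolding igens_def by auto
      have "g \<in> ideal_I n k"
      proof (cases "g \<in> ?G")
        case False
        then have "g = elem_sym n e" "n < e + k" "e \<notin> {n - k + 1..n}"
          using p(3) by (auto simp: gens_def)
        then have "g = 0"
          using assms by (intro trans[OF \<open>g = elem_sym n e\<close> elem_sym_gt]) auto
        then show ?thesis
          using I.zero_closed by simp
      qed (use GI in blast)
      then show "p \<in> ideal_I n k"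
        using I.I_l_closed[of g "mmon u"] p mmon_mem_mpolys by simp
    qed
    moreover have "mp.subspace (ideal_I n k)"
      using I.zero_closed I.a_closed I.I_l_closed mconst_mem_mpolys by (intro mp.subspaceI) auto
    ultimately show "ispan n k \<subseteq> ideal_I n k"
      unfolding ispan_def by (intro mp.span_minimal) auto
  qed
qed

lemma subfield_mconst: "subfield (range mconst) (mpoly_ring n)"
proof -
  interpret cring "mpoly_ring n"
    by (rule mpoly_ring_cring)
  have "subring (range mconst) (mpoly_ring n)"
  proof (rule subringI)
    show "\<one>\<^bsub>mpoly_ring n\<^esub> \<in> range mconst"
      using mconst_one by (metis mpoly_ring_simps(4) rangeI)
    fix a assume "a \<in> range mconst"
    then obtain c where "a = mconst c"
      by auto
    then have "\<ominus>\<^bsub>mpoly_ring n\<^esub> a = mconst (- c)"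
      using a_inv_mpoly_ring[OF mconst_mem_mpolys] by (simp add: mconst_uminus)
    then show "\<ominus>\<^bsub>mpoly_ring n\<^esub> a \<in> range mconst"
      by simp
  qed (auto simp: mconst_mem_mpolys simp flip: mconst_add mconst_mult)
  then have "subcring (range mconst) (mpoly_ring n)"
    by (intro subcringI) (auto simp: mult.commute)
  moreover have "Units (mpoly_ring n\<lparr>carrier := range mconst\<rparr>) = range mconst - {\<zero>\<^bsub>mpoly_ring n\<^esub>}"
  proof (intro equalityI subsetI)
    fix x assume "x \<in> Units (mpoly_ring n\<lparr>carrier := range mconst\<rparr>)"
    then show "x \<in> range mconst - {\<zero>\<^bsub>mpoly_ring n\<^esub>}"
      unfolding Units_def by auto
  next
    fix x assume "x \<in> range mconst - {\<zero>\<^bsub>mpoly_ring n\<^esub>}"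
    then obtain c where "x = mconst c" "c \<noteq> 0"
      using mconst_zero by (metis DiffE imageE insertI1 mpoly_ring_simps(5))
    show "x \<in> Units (mpoly_ring n\<lparr>carrier := range mconst\<rparr>)"
    proof -
      have "mconst (1 / c) * x = 1" "x * mconst (1 / c) = 1"
        using \<open>x = mconst c\<close> \<open>c \<noteq> 0\<close> by (simp_all flip: mconst_mult)
      then show ?thesis
        using \<open>x = mconst c\<close> unfolding Units_def by auto
    qed
  qed
  ultimately show ?thesis
    by (rule subfieldI)
qed

lemma OP_nonempty:
  assumes "1 \<le> k" "k \<le> n"
  shows "OP n k \<noteq> {}"
  using coeff_0_coinv_gf[OF assms] by (auto simp: coinv_gf_def)

section \<open>Dimensions in the quotient\<close>

definition qmap :: "nat \<Rightarrow> nat \<Rightarrow> mpoly \<Rightarrow> mpoly set" where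
  "qmap n k p = ideal_I n k +>\<^bsub>mpoly_ring n\<^esub> p"

context
  fixes n k :: nat
  assumes k: "1 \<le> k" "k \<le> n"
begin

lemma ring_hom_qmap: "ring_hom_ring (mpoly_ring n) (ring_R n k) (qmap n k)"
  using ideal.rcos_ring_hom_ring[OF ideal_ispan[of n k]]
  unfolding ring_R_def qmap_def ideal_I_eq_ispan[OF k(2)] .

interpretation Q: ring_hom_ring "mpoly_ring n" "ring_R n k" "qmap n k"
  by (rule ring_hom_qmap)

lemma qmap_eq_iff:
  assumes "p \<in> mpolys n" "q \<in> mpolys n"
  shows "qmap n k p = qmap n k q \<longleftrightarrow> p - q \<in> ispan n k"
  using Q.R.quotient_eq_iff_same_a_r_cos[OF ideal_ispan[of n k], of p q] assms
  unfolding qmap_def ideal_I_eq_ispan[OF k(2)] by (simp add: a_minus_def a_inv_mpoly_ring)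

lemma qmap_carrier: "carrier (ring_R n k) = qmap n k ` mpolys n"
  unfolding ring_R_def FactRing_def A_RCOSETS_def' qmap_def by auto

text \<open>If 1 were in the ideal, so would be a staircase monomial, against
  \<open>stairs_independent\<close> with \<open>q = 0\<close>. This makes the image of the constants
  a field.\<close>

lemma ring_R_nontrivial: "\<one>\<^bsub>ring_R n k\<^esub> \<noteq> \<zero>\<^bsub>ring_R n k\<^esub>"
proof
  assume "\<one>\<^bsub>ring_R n k\<^esub> = \<zero>\<^bsub>ring_R n k\<^esub>"
  then have "qmap n k 1 = qmap n k 0"
    using Q.hom_one Q.hom_zero by simp
  then have one: "1 \<in> ispan n k"
    using qmap_eq_iff[OF mpolys_1 mpolys_0] by simp
  have "card (stairs n k k) \<noteq> 0"
    using OP_nonempty[OF k] by (simp add: card_stairs)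
  then obtain t where t: "t \<in> stairs n k k"
    by fastforce
  then have "mmon t * 1 \<in> ispan n k"
    using stairs_expos by (intro ispan_mult_closed[OF mmon_mem_mpolys one]) auto
  then show False
    using stairs_independent[OF t mp.span_zero] by simp
qed

lemma subfield_scalars: "subfield (scalars n k) (ring_R n k)"
  using Q.img_is_subfield(2)[OF subfield_mconst ring_R_nontrivial]
  unfolding scalars_def qmap_def by (simp add: image_image)

text \<open>Translates the list-based \<open>Span\<close> over the subfield
  \<open>scalars n k\<close> of the quotient into \<open>mp.span\<close> of polynomials, where the
  earlier results live.\<close>

lemma Span_qmap:
  assumes "set ts \<subseteq> expos n"
  shows "Q.S.Span (scalars n k) (map (\<lambda>t. qmap n k (mmon t)) ts) = qmap n k ` mp.span (mmon ` set ts)"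
  using assms
proof (induction ts)
  case Nil
  then show ?case
    using Q.hom_zero by simp
next
  case (Cons t ts)
  have t: "mmon t \<in> mpolys n"
    using Cons.prems mmon_mem_mpolys by simp
  have carr: "q \<in> mpolys n" if "q \<in> mp.span (mmon ` set ts)" for q
    using that span_subset_mpolys[of "mmon ` set ts" n] mmon_mem_mpolys Cons.prems by auto
  have lin: "qmap n k (mconst c) \<otimes>\<^bsub>ring_R n k\<^esub> qmap n k (mmon t) \<oplus>\<^bsub>ring_R n k\<^esub> qmap n k q
      = qmap n k (mconst c * mmon t + q)" if "q \<in> mp.span (mmon ` set ts)" for c q
    using Q.hom_mult[of "mconst c" "mmon t"] Q.hom_add[of "mconst c * mmon t" q]
      t carr[OF that] mconst_mem_mpolys mpolys_mult by simp
  have "Q.S.Span (scalars n k) (map (\<lambda>t. qmap n k (mmon t)) (t # ts))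
      = Q.S.line_extension (scalars n k) (qmap n k (mmon t)) (qmap n k ` mp.span (mmon ` set ts))"
    using Cons by simp
  also have "\<dots> = {qmap n k (mconst c * mmon t + q) | c q. q \<in> mp.span (mmon ` set ts)}"
  proof (intro Set.set_eqI)
    fix x
    show "x \<in> Q.S.line_extension (scalars n k) (qmap n k (mmon t)) (qmap n k ` mp.span (mmon ` set ts))
      \<longleftrightarrow> x \<in> {qmap n k (mconst c * mmon t + q) | c q. q \<in> mp.span (mmon ` set ts)}"
      unfolding Q.S.line_extension_mem_iff scalars_def qmap_def[symmetric] using lin by auto
  qed
  also have "\<dots> = qmap n k ` mp.span (mmon ` set (t # ts))"
  proof (intro Set.set_eqI iffI)
    fix x assume "x \<in> {qmap n k (mconst c * mmon t + q) | c q. q \<in> mp.span (mmon ` set ts)}"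
    then obtain c q where "x = qmap n k (mconst c * mmon t + q)" "q \<in> mp.span (mmon ` set ts)"
      by blast
    moreover from this have "mconst c * mmon t + q \<in> mp.span (mmon ` set (t # ts))"
      by (auto simp: mp.span_insert intro!: exI[of _ c])
    ultimately show "x \<in> qmap n k ` mp.span (mmon ` set (t # ts))"
      by blast
  next
    fix x assume "x \<in> qmap n k ` mp.span (mmon ` set (t # ts))"
    then obtain p c where p: "x = qmap n k p" "p - mconst c * mmon t \<in> mp.span (mmon ` set ts)"
      by (auto simp: mp.span_insert)
    then have "x = qmap n k (mconst c * mmon t + (p - mconst c * mmon t))"
      by simp
    then show "x \<in> {qmap n k (mconst c * mmon t + q) | c q. q \<in> mp.span (mmon ` set ts)}"
      using p(2) by blast
  qed
  finally show ?case .
qed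

lemma independent_qmap:
  assumes "set ts \<subseteq> stairs n k k" "distinct ts"
  shows "Q.S.independent (scalars n k) (map (\<lambda>t. qmap n k (mmon t)) ts)"
  using assms
proof (induction ts)
  case (Cons t ts)
  have expos: "set (t # ts) \<subseteq> expos n"
    using Cons.prems stairs_expos by blast
  have t: "mmon t \<in> mpolys n"
    using expos mmon_mem_mpolys by simp
  have "qmap n k (mmon t) \<notin> qmap n k ` mp.span (mmon ` set ts)"
  proof
    assume "qmap n k (mmon t) \<in> qmap n k ` mp.span (mmon ` set ts)"
    then obtain q where q: "qmap n k (mmon t) = qmap n k q" "q \<in> mp.span (mmon ` set ts)"
      by blast
    moreover from q(2) have "q \<in> mpolys n"
      using span_subset_mpolys[of "mmon ` set ts" n] mmon_mem_mpolys expos by auto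
    ultimately have "mmon t - q \<in> ispan n k"
      using qmap_eq_iff t by simp
    moreover have "q \<in> mp.span (mmon ` (stairs n k k - {t}))"
      using q(2) mp.span_mono[of "mmon ` set ts" "mmon ` (stairs n k k - {t})"] Cons.prems by auto
    ultimately show False
      using stairs_independent Cons.prems by auto
  qed
  moreover have "qmap n k (mmon t) \<in> carrier (ring_R n k)"
    using t qmap_carrier by blast
  ultimately show ?case
    using Cons Span_qmap[of ts] expos by (auto intro!: Q.S.independent.li_Cons simp del: Q.S.Span.simps)
qed simp

text \<open>For arbitrary \<open>T\<close>, since it is applied both to the monomials of one degree
  and to all of them.\<close>

lemma dimension_qmap:
  assumes "T \<subseteq> stairs n k k"
  shows "Q.S.dimension (card T) (scalars n k) (qmap n k ` mp.span (mmon ` T))"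
proof -
  have "finite T"
    using assms finite_subset[OF _ finite_stairs] by blast
  then obtain ts where ts: "set ts = T" "distinct ts"
    using finite_distinct_list by blast
  have "Q.S.dimension (length ts) (scalars n k) (qmap n k ` mp.span (mmon ` T))"
  proof -
    have "set ts \<subseteq> stairs n k k" "set ts \<subseteq> expos n"
      using ts assms stairs_expos by blast+
    then show ?thesis
      using Q.S.dimension_independent[OF independent_qmap[of ts]] Span_qmap[of ts] ts
      by (simp only: length_map)
  qed
  then show ?thesis
    using ts distinct_card[of ts] by simp
qed

lemma dim_Q_qmap:
  assumes "T \<subseteq> stairs n k k"
  shows "dim_Q n k (qmap n k ` mp.span (mmon ` T)) = card T"
  using Q.S.dimI[OF subfield_scalars dimension_qmap[OF assms]] by (simp add: dim_Q_def over_def)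

lemma qmap_reduce:
  assumes "S \<subseteq> ispan n k" "p \<in> mp.span (S \<union> mmon ` T)" "T \<subseteq> expos n"
  shows "qmap n k p \<in> qmap n k ` mp.span (mmon ` T)"
proof -
  obtain i q where p: "p = i + q" "i \<in> mp.span S" "q \<in> mp.span (mmon ` T)"
    using assms(2) unfolding mp.span_Un by auto
  have "i \<in> ispan n k"
    using p(2) assms(1) mp.span_minimal[of S "ispan n k"] unfolding ispan_def by auto
  moreover have "q \<in> mpolys n"
    using p(3) assms(3) span_subset_mpolys[of "mmon ` T" n] mmon_mem_mpolys by auto
  ultimately have "qmap n k p = qmap n k q"
    using p(1) ispan_subset_mpolys[of n k] mpolys_add[of i n q] by (subst qmap_eq_iff) auto
  then show ?thesis
    using p(3) by blast
qed

lemma igens_subset_ispan: "igens n k k d \<subseteq> ispan n k"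
  unfolding ispan_def by (auto intro: mp.span_base)

lemma carrier_eq_qmap_stairs: "carrier (ring_R n k) = qmap n k ` mp.span (mmon ` stairs n k k)"
proof (intro equalityI subsetI)
  fix x assume "x \<in> carrier (ring_R n k)"
  then obtain p where p: "x = qmap n k p" "p \<in> mpolys n"
    using qmap_carrier by blast
  have "hspan n k k d \<subseteq> mp.span (ispan n k \<union> mmon ` stairs n k k)" for d
    unfolding hspan_def using igens_subset_ispan by (intro mp.span_mono) auto
  then have "mmon ` expos n \<subseteq> mp.span (ispan n k \<union> mmon ` stairs n k k)"
    using mmon_mem_hspan by blast
  then have "p \<in> mp.span (ispan n k \<union> mmon ` stairs n k k)"
    using p(2) mp.span_minimal[OF _ mp.subspace_span] unfolding mpolys_eq_span by blast
  then show "x \<in> qmap n k ` mp.span (mmon ` stairs n k k)"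
    using qmap_reduce stairs_expos p(1) by blast
next
  fix x assume "x \<in> qmap n k ` mp.span (mmon ` stairs n k k)"
  then show "x \<in> carrier (ring_R n k)"
    using span_subset_mpolys[of "mmon ` stairs n k k" n] mmon_mem_mpolys stairs_expos qmap_carrier
    by blast
qed

text \<open>\<open>hspan\<close> in degree \<open>d\<close> only uses staircase monomials of degree
  \<open>d\<close>, so reducing a homogeneous polynomial modulo the ideal stays in its
  degree.\<close>

lemma graded_part_eq_qmap_stairs:
  "graded_part n k d = qmap n k ` mp.span (mmon ` {t \<in> stairs n k k. mon_degree t = d})"
proof -
  let ?T = "{t \<in> stairs n k k. mon_degree t = d}"
  have gp: "graded_part n k d = qmap n k ` mp.span (mmon ` {t \<in> expos n. mon_degree t = d})"
    unfolding graded_part_def qmap_def using homogeneous_iff_span[of _ n d] by blast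
  have "mmon ` {t \<in> expos n. mon_degree t = d} \<subseteq> hspan n k k d"
    using mmon_mem_hspan by auto
  then have "mp.span (mmon ` {t \<in> expos n. mon_degree t = d}) \<subseteq> hspan n k k d"
    unfolding hspan_def by (intro mp.span_minimal) auto
  then have "qmap n k p \<in> qmap n k ` mp.span (mmon ` ?T)"
    if "p \<in> mp.span (mmon ` {t \<in> expos n. mon_degree t = d})" for p
    using that qmap_reduce[OF igens_subset_ispan] stairs_expos unfolding hspan_def by blast
  moreover have "mp.span (mmon ` ?T) \<subseteq> mp.span (mmon ` {t \<in> expos n. mon_degree t = d})"
    using stairs_expos[of n k k] by (intro mp.span_mono image_mono) blast
  ultimately show ?thesis
    unfolding gp by blast
qed

lemma Hilb_eq_coinv_gf: "Hilb n k = fps_of_poly (coinv_gf n k)"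
proof (rule fps_ext)
  fix d
  have "fps_nth (Hilb n k) d = int (card {t \<in> stairs n k k. mon_degree t = d})"
    by (simp add: Hilb_def graded_part_eq_qmap_stairs dim_Q_qmap)
  also have "\<dots> = poly.coeff (stairs_gf n k k) d"
    by (simp add: stairs_gf_def coeff_sum sum.If_cases Int_def)
  finally show "fps_nth (Hilb n k) d = fps_nth (fps_of_poly (coinv_gf n k)) d"
    by (simp add: stairs_gf_eq_coinv_gf)
qed

text \<open>Finite dimension is asserted too, since \<open>dim\<close> is a natural number and would
  say nothing otherwise.\<close>

lemma dimension_carrier:
  "Q.S.finite_dimension (scalars n k) (carrier (ring_R n k))"
  "dim_Q n k (carrier (ring_R n k)) = card (OP n k)"
  unfolding carrier_eq_qmap_stairs using dimension_qmap[OF order_refl] dim_Q_qmap[OF order_refl]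
  by (auto simp: card_stairs intro: Q.S.finite_dimensionI)

end

theorem theorem4p10:
  fixes n k :: nat
  assumes "1 \<le> k" and "k \<le> n"
  shows "Hilb n k = fps_of_poly (\<Sum>\<sigma>\<in>OP n k. Polynomial.monom 1 (coinv n k \<sigma>))
    \<and> (\<Sum>\<sigma>\<in>OP n k. Polynomial.monom 1 (coinv n k \<sigma>)) = reflect_poly (q_fact k * q_stirling n k)
    \<and> ring.finite_dimension (ring_R n k) (scalars n k) (carrier (ring_R n k))
    \<and> dim_Q n k (carrier (ring_R n k)) = card (OP n k)
    \<and> card (OP n k) = fact k * Stirling n k"
proof -
  have "inv_gf n k = q_fact k * q_stirling n k"
    using inv_gf_eq_q_stirling[of "n - 1" k] assms by simp
  then show ?thesis
    using Hilb_eq_coinv_gf[OF assms] coinv_gf_eq_reflect_poly[OF assms] dimension_carrier[OF assms]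
      card_OP[of n k]
    by (simp add: coinv_gf_def)
qed

end
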